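(* Let $G$ be a finitely generated group of polynomial volume growth, $\mu\in\mathcal P_{\preceq}(G,\mathrm{reg})$, and let $(\Sigma_G,\mathfrak F_G)$ and $(\Sigma_N,\mathfrak F_N)$ be an adapted pair of geometries (built from a normal nilpotent subgroup $N$ of finite index). Then there are constants $0<c\le C<\infty$ such that $$c\|g\|_{\mathfrak F_G}\le\|g\|_{\mathfrak F_N}\le C\|g\|_{\mathfrak F_G}\qquad\text{for all } g\in N.$$
   Context: Notation. For positive functions $f_1,f_2$ on a set $D$, $f_1\asymp f_2$ means there are constants $0<c_1\le c_2<\infty$ with $c_1f_1\le f_2\le c_2f_1$ on $D$. For positive functions on $D=[1,\infty)$ (or on a neighbourhood of infinity), $f_1\preceq f_2$ means there are constants $c_1,c_2>0$ with $f_1(t)\le c_1f_2(c_2t)$ for all $t\in D$. A positive function $f$ is regularly varying of index $\gamma$ at infinity if $f(\lambda t)/f(t)\to\lambda^\gamma$ as $t\to\infty$ for every $\lambda>0$. Word length $|\cdot|$ w.r.t. a finite symmetric generating set; polynomial volume growth of degree $d$ means $\#\{|h|\le r\}\asymp r^d$ on $[1,\infty)$. The class $\mathcal P_{\preceq}(G,\mathrm{reg})$. $G$ is a finitely generated group of polynomial volume growth. $\mu=\sum_{i=0}^kp_i\mu_i$ with $k\ge0$, $p_0\ge0$, $p_i>0$ ($1\le i\le k$), $\sum p_i=1$, each $\mu_i$ a symmetric probability measure; $\mu_0$ finitely supported; for $1\le i\le k$, $\mu_i(h)\asymp[\phi_i(1+|h|_i)(1+|h|_i)^{d_i}]^{-1}$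 on a subgroup $H_i$ (word length $|\cdot|_i$, polynomial growth degree $d_i$) and $0$ off $H_i$, where $\phi_i$ is positive, increasing, regularly varying of positive index at infinity; the finite set $\{g:\mu(g)>\varepsilon\}$ generates $G$ and contains $e$ for some $\varepsilon>0$. $\Phi_0(t)=\max\{t,t^2\}$; for $1\le i\le k$, $\Phi_i(t)=t^2/\int_0^t\frac{2s}{\phi_i(s)}ds$ for $t\ge1$, extended linearly on $[0,1]$ with $\Phi_i(0)=0$; and for distinct $i,j\ge1$ either $\Phi_i\preceq\Phi_j$ or $\Phi_j\preceq\Phi_i$ near infinity. Weight function systems. Given a group $G$ and a finite tuple $\Sigma$ of elements of $G$ (regarded also as abstract letters), a weight function system $\mathfrak F=\{F_s:s\in\Sigma\}$ is a family of continuous strictly increasing functions $F_s:[0,\infty)\to[0,\infty)$ with $F_s(t)\asymp t$ on $[0,1]$, such that for all $s,s'\in\Sigma$ either $F_s\preceq F_{s'}$ or $F_{s'}\preceq F_s$ on a neighbourhood of infinity. For a finite word $\omega$ over $\Sigma\cup\Sigma^{-1}$ (formal inverses) and $s\in\Sigma$, $\deg_s(\omega)$ is the number of occurrences of the letters $s$ or $s^{-1}$ in $\omega$. For $g\in G$, $\|g\|_{\mathfrak F}=\inf\{\max_{s\in\Sigma}F_s^{-1}(\deg_s(\omega)):\ \omega \text{ a finite word over }\Sigma\cup\Sigma^{-1}\text{ equal to } g \text{ in } G\}$, with $\|e\|_{\mathfrak F}=0$ and $\|g\|_{\mathfrak F}=\infty$ if no such word exists. Adapted geometries. Fix a normal nilpotent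 subgroup $N$ of finite index in $G$ and coset representatives $u_0=e,u_1,\dots,u_m$ with $G=\bigsqcup_\ell Nu_\ell$. Let $N_i=N\cap H_i$ ($1\le i\le k$), $S_0$ a finite symmetric generating set of $G$, and $S_i$ a finite symmetric generating set of $N_i$ ($1\le i\le k$). Let $\Sigma_G$ be a set of representatives of $(\bigcup_{i=0}^kS_i)\setminus\{e\}$ modulo $g\sim g^{-1}$, and $F_{G,s}=\max\{\Phi_i^{-1}: 0\le i\le k,\ s\in S_i\}$ for $s\in\Sigma_G$; $\mathfrak F_G=\{F_{G,s}\}$. Let $\Xi_0$ be a finite symmetric generating set of $N$, $\Xi_i=\bigcup_{\ell=0}^m u_\ell S_iu_\ell^{-1}$ ($1\le i\le k$), $\Sigma_N$ a set of representatives of $(\bigcup_{i=0}^k\Xi_i)\setminus\{e\}$ modulo $g\sim g^{-1}$, and $F_{N,s}=\max\{\Phi_i^{-1}: 0\le i\le k,\ s\in\Xi_i\}$; $\mathfrak F_N=\{F_{N,s}\}$ (a weight function system on the group $N$). *)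

theory Defs
  imports "HOL-Analysis.Analysis" "HOL-Algebra.Algebra"
begin

definition list_prod :: "('a, 'b) monoid_scheme \<Rightarrow> 'a list \<Rightarrow> 'a" where
  "list_prod G xs = foldr (\<lambda>x y. x \<otimes>\<^bsub>G\<^esub> y) xs \<one>\<^bsub>G\<^esub>"

definition fin_sym_gen :: "('a, 'b) monoid_scheme \<Rightarrow> 'a set \<Rightarrow> 'a set \<Rightarrow> bool" where
  "fin_sym_gen G S H \<longleftrightarrow> finite S \<and> S \<subseteq> carrier G \<and> (\<forall>s\<in>S. inv\<^bsub>G\<^esub> s \<in> S)
     \<and> generate G S = H"

definition word_length :: "('a, 'b) monoid_scheme \<Rightarrow> 'a set \<Rightarrow> 'a \<Rightarrow> nat" where
  "word_length G S h = (LEAST n. \<exists>xs. length xs = n \<and> set xs \<subseteq> S \<and> list_prod G xs = h)"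

definition poly_growth_deg :: "('a, 'b) monoid_scheme \<Rightarrow> 'a set \<Rightarrow> 'a set \<Rightarrow> real \<Rightarrow> bool" where
  "poly_growth_deg G S H d \<longleftrightarrow>
     (\<exists>c1 c2. 0 < c1 \<and> c1 \<le> c2 \<and> (\<forall>r::real. r \<ge> 1 \<longrightarrow>
        c1 * r powr d \<le> real (card {h \<in> H. real (word_length G S h) \<le> r}) \<and>
        real (card {h \<in> H. real (word_length G S h) \<le> r}) \<le> c2 * r powr d))"

definition commutator :: "('a, 'b) monoid_scheme \<Rightarrow> 'a \<Rightarrow> 'a \<Rightarrow> 'a" where
  "commutator G x y = x \<otimes>\<^bsub>G\<^esub> y \<otimes>\<^bsub>G\<^esub> inv\<^bsub>G\<^esub> x \<otimes>\<^bsub>G\<^esub> inv\<^bsub>G\<^esub> y"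

fun lower_central :: "('a, 'b) monoid_scheme \<Rightarrow> 'a set \<Rightarrow> nat \<Rightarrow> 'a set" where
  "lower_central G N 0 = N"
| "lower_central G N (Suc n) =
     generate G {commutator G x y | x y. x \<in> N \<and> y \<in> lower_central G N n}"

definition nilpotent_subgroup :: "('a, 'b) monoid_scheme \<Rightarrow> 'a set \<Rightarrow> bool" where
  "nilpotent_subgroup G N \<longleftrightarrow> subgroup N G \<and> (\<exists>n. lower_central G N n = {\<one>\<^bsub>G\<^esub>})"

definition preceq_inf :: "(real \<Rightarrow> real) \<Rightarrow> (real \<Rightarrow> real) \<Rightarrow> bool" where
  "preceq_inf f g \<longleftrightarrow> (\<exists>c1 c2 T. c1 > 0 \<and> c2 > 0 \<and> (\<forall>t\<ge>T. f t \<le> c1 * g (c2 * t)))"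

definition regularly_varying :: "(real \<Rightarrow> real) \<Rightarrow> real \<Rightarrow> bool" where
  "regularly_varying f \<gamma> \<longleftrightarrow>
     (\<forall>a>0. ((\<lambda>t. f (a * t) / f t) \<longlongrightarrow> a powr \<gamma>) at_top)"

text \<open>Inverse of a nondecreasing function on [0,\<infinity>) (the largest preimage; this is the
  ordinary inverse for continuous strictly increasing unbounded f with f 0 = 0).\<close>
definition inv_fun :: "(real \<Rightarrow> real) \<Rightarrow> real \<Rightarrow> real" where
  "inv_fun f y = Sup {t. 0 \<le> t \<and> f t \<le> y}"

definition Phi0 :: "real \<Rightarrow> real" where
  "Phi0 t = max t (t^2)"

definition PhiI :: "(real \<Rightarrow> real) \<Rightarrow> real \<Rightarrow> real" where
  "PhiI \<phi> t = (if t \<ge> 1 then t^2 / integral {0..t} (\<lambda>s. 2 * s / \<phi> s)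
               else t * (1 / integral {0..1} (\<lambda>s. 2 * s / \<phi> s)))"

definition Phi :: "(nat \<Rightarrow> real \<Rightarrow> real) \<Rightarrow> nat \<Rightarrow> real \<Rightarrow> real" where
  "Phi \<phi> i = (if i = 0 then Phi0 else PhiI (\<phi> i))"

definition word_eval :: "('a, 'b) monoid_scheme \<Rightarrow> ('a \<times> bool) list \<Rightarrow> 'a" where
  "word_eval G w = list_prod G (map (\<lambda>(s, b). if b then s else inv\<^bsub>G\<^esub> s) w)"

definition word_deg :: "'a \<Rightarrow> ('a \<times> bool) list \<Rightarrow> nat" where
  "word_deg s w = length (filter (\<lambda>x. fst x = s) w)"

text \<open>\<parallel>g\<parallel>_F = inf over words \<omega> equal to g of max_s F_s^{-1}(deg_s \<omega>); \<infinity> if no word.\<close>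
definition wnorm :: "('a, 'b) monoid_scheme \<Rightarrow> 'a set \<Rightarrow> ('a \<Rightarrow> real \<Rightarrow> real) \<Rightarrow> 'a \<Rightarrow> ereal" where
  "wnorm G \<Sigma> F g =
     (if g = \<one>\<^bsub>G\<^esub> then 0 else
      Inf {ereal (Max (insert 0 ((\<lambda>s. inv_fun (F s) (real (word_deg s w))) ` \<Sigma>))) | w.
             set (map fst w) \<subseteq> \<Sigma> \<and> word_eval G w = g})"

definition reps_mod_inv :: "('a, 'b) monoid_scheme \<Rightarrow> 'a set \<Rightarrow> 'a set \<Rightarrow> bool" where
  "reps_mod_inv G \<Sigma> U \<longleftrightarrow> \<Sigma> \<subseteq> U \<and>
     (\<forall>x\<in>U. \<exists>!s. s \<in> \<Sigma> \<and> (s = x \<or> s = inv\<^bsub>G\<^esub> x))"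

definition weight_fun :: "(nat \<Rightarrow> real \<Rightarrow> real) \<Rightarrow> nat \<Rightarrow> (nat \<Rightarrow> 'a set) \<Rightarrow> 'a \<Rightarrow> real \<Rightarrow> real" where
  "weight_fun \<phi> k A s t = Max ((\<lambda>i. inv_fun (Phi \<phi> i) t) ` {i. i \<le> k \<and> s \<in> A i})"

end

(* A word over SG with value in N is rewritten by walking through the cosets N u_l: a letter s in
   some S_i with i >= 1 lies in N and becomes the letter u_l s u_l^-1 of Xi_i, every other letter
   becomes a word of bounded length over Xi_0.  This costs only constant factors.

   The converse cannot be done letter by letter, since conjugating back each occurrence of
   u_l s u_l^-1 would spend too many letters of S_0.  In a nilpotent group, however, a word that
   uses each generator s at most d_s times equals a product of boundedly many powers s^n with
   n <= d_s, and in such a product (u_l s u_l^-1)^n = u_l s^n u_l^-1 costs boundedly many letters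
   of S_0.  For this, words in formal commutators are collected, where a commutator with leaves
   s_1, ..., s_q may occur O(d_(s_1) ... d_(s_q)) times.  The power n = a b of c = [x, y] with
   a <= d_x and b <= d_y is, up to longer commutators, the commutator of x^a and y^b, which by
   induction are products of boundedly many powers of generators, up to longer commutators.

   Finally, the inverse of a weight function max_i Phi_i^-1 is comparable to min_i Phi_i, and every
   Phi_i is nondecreasing with Phi_i(c t) <= c^2 Phi_i(t) for c >= 1. *)

theory Submission
  imports Defs
begin

section \<open>Words in formal commutators\<close>

text \<open>The number of powers must not depend on the word, so everything is proved for families
  of elements indexed by all words at once, with constants that depend on the tree alone. Trees are
  counted instead of their values because a group element does not determine its leaves and so has
  no weight. Weights multiply along \<open>Node\<close>, and so do counts when letters cross;
  therefore a bound of the form constant times \<open>cwt\<close> survives every rearrangement. Over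
  a finite alphabet only finitely many trees have a given number of leaves, and in a nilpotent group
  those with many leaves have value one, so finitely many rounds of collecting suffice. Weights have
  to be at least 1, since exponents are split by division with remainder. A word is thus charged an
  extra 1 for each generator, and this is affordable because a word for a nontrivial element
  contains at least one letter.\<close>

datatype 'a ctree = Leaf 'a | Node "'a ctree" "'a ctree"

primrec csize :: "'a ctree \<Rightarrow> nat" where
  "csize (Leaf s) = 1"
| "csize (Node x y) = csize x + csize y"

primrec cheight :: "'a ctree \<Rightarrow> nat" where
  "cheight (Leaf s) = 0"
| "cheight (Node x y) = Suc (max (cheight x) (cheight y))"

primrec cwt :: "('a \<Rightarrow> nat) \<Rightarrow> 'a ctree \<Rightarrow> nat" where
  "cwt d (Leaf s) = d s"
| "cwt d (Node x y) = cwt d x * cwt d y"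

text \<open>Moving a letter \<open>x\<close> to the left past a letter \<open>y\<close> leaves the new letter \<open>Node y x\<close> behind.
  Starting with letter counts \<open>f\<close> and moving letters with counts \<open>g\<close>, this recursion bounds the
  resulting counts.\<close>

primrec count_bound :: "('a ctree \<Rightarrow> nat) \<Rightarrow> ('a ctree \<Rightarrow> nat) \<Rightarrow> 'a ctree \<Rightarrow> nat" where
  "count_bound f g (Leaf s) = f (Leaf s)"
| "count_bound f g (Node y x) = f (Node y x) + g x * count_bound f g y"

text \<open>What \<open>w\<close> turns into when \<open>x\<close> crosses it from right to left: y
  x = x y [y, x], where [y, x] = y^-1 x^-1 y x is the value of \<open>Node y x\<close>. Iterated,
  \<open>push w v\<close> stands for the conjugate v^-1 w v.\<close>

definition push1 :: "'a ctree list \<Rightarrow> 'a ctree \<Rightarrow> 'a ctree list" where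
  "push1 w x = concat (map (\<lambda>y. [y, Node y x]) w)"

primrec push :: "'a ctree list \<Rightarrow> 'a ctree list \<Rightarrow> 'a ctree list" where
  "push w [] = w"
| "push w (x # v) = push (push1 w x) v"

text \<open>\<open>comm1\<close> and \<open>commw\<close> spell out the identities [y, x v] = [y, v]
  v^-1 [y, x] v and [y w, v] = w^-1 [y, v] w [w, v].\<close>

primrec comm1 :: "'a ctree \<Rightarrow> 'a ctree list \<Rightarrow> 'a ctree list" where
  "comm1 y [] = []"
| "comm1 y (x # v) = comm1 y v @ push [Node y x] v"

primrec commw :: "'a ctree list \<Rightarrow> 'a ctree list \<Rightarrow> 'a ctree list" where
  "commw [] v = []"
| "commw (y # w) v = push (comm1 y v) w @ commw w v"

text \<open>Splits off a power of \<open>x\<close>: its occurrences travel to the front and are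
  removed there. \<open>acc\<close> holds the letters already passed, which later occurrences of
  \<open>x\<close> still have to cross.\<close>

primrec collect :: "'a ctree \<Rightarrow> 'a ctree list \<Rightarrow> 'a ctree list \<Rightarrow> 'a ctree list" where
  "collect x acc [] = acc"
| "collect x acc (y # w) = (if y = x then collect x (push1 acc x) w else collect x (acc @ [y]) w)"

lemma csize_pos [simp]: "0 < csize t"
  by (induction t) auto

lemma csize_le_pow_height: "csize t \<le> 2 ^ cheight t"
proof (induction t)
  case (Node x y)
  have "csize x \<le> 2 ^ max (cheight x) (cheight y)" "csize y \<le> 2 ^ max (cheight x) (cheight y)"
    by (rule order_trans[OF Node(1)] order_trans[OF Node(2)]; rule power_increasing; simp)+
  then show ?case by simp
qed auto

lemma push1_simps [simp]: "push1 [] x = []" "push1 (y # w) x = y # Node y x # push1 w x"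
  "push1 (w @ w') x = push1 w x @ push1 w' x"
  by (auto simp: push1_def)

lemma push_Nil [simp]: "push [] v = []"
  by (induction v) auto

lemma push_append: "push (w @ w') v = push w v @ push w' v"
  by (induction v arbitrary: w w') auto

text \<open>This is v^-1 y v = y [y, v].\<close>

lemma push_single: "push [y] v = y # comm1 y v"
proof (induction v arbitrary: y)
  case (Cons x v)
  have "push [y] (x # v) = push ([y] @ [Node y x]) v" by simp
  also have "\<dots> = push [y] v @ push [Node y x] v" by (rule push_append)
  finally show ?case using Cons by simp
qed simp

lemma push_Cons_left: "push (y # w) v = y # comm1 y v @ push w v"
  using push_append[of "[y]" w v] by (simp add: push_single)

section \<open>Letter counts after crossings\<close>

lemma count_push1: "count_list (push1 w x) t =
   count_list w t + (case t of Leaf s \<Rightarrow> 0 | Node y z \<Rightarrow> if z = x then count_list w y else 0)"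
  by (induction w) (auto split: ctree.splits)

lemma count_bound_mono: "(\<And>t. f t \<le> f' t) \<Longrightarrow> (\<And>t. g t \<le> g' t) \<Longrightarrow> count_bound f g t \<le> count_bound f' g' t"
  by (induction t) (auto intro!: add_mono mult_mono)

lemma count_bound_add: "count_bound (\<lambda>t. f t + f' t) g t = count_bound f g t + count_bound f' g t"
  by (induction t) (auto simp: algebra_simps)

lemma count_bound_ge: "f t \<le> count_bound f g t"
  by (cases t) auto

text \<open>Both recursions multiply along a \<open>Node\<close>, so the weights factor out and the
  remaining constant depends on the tree but not on \<open>d\<close>. This keeps all later estimates
  uniform in the word.\<close>

lemma count_bound_cwt: "count_bound (\<lambda>t. C t * cwt d t) (\<lambda>t. C' t * cwt d t) t = count_bound C C' t * cwt d t"
  by (induction t) (auto simp: algebra_simps)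

text \<open>A crossing by \<open>x\<close> adds f(y) letters \<open>Node y x\<close>; raising
  \<open>g\<close> at \<open>x\<close> by one pays for them, because \<open>count_bound\<close> at y
  is at least f(y). The summand \<open>h\<close> stands for letters that this \<open>x\<close> does
  not cross but later ones may.\<close>

lemma count_bound_shift:
  "count_bound (\<lambda>t. f t + (case t of Leaf s \<Rightarrow> 0 | Node y z \<Rightarrow> if z = x then f y else 0) + h t) g t
    \<le> count_bound (\<lambda>t. f t + h t) (\<lambda>z. g z + (if z = x then 1 else 0)) t"
proof (induction t)
  case (Node y z)
  let ?B = "count_bound (\<lambda>t. f t + h t) (\<lambda>z. g z + (if z = x then 1 else 0)) y"
  have "f y + h y \<le> ?B" by (rule count_bound_ge)
  from this Node(1) have "f y + h y + g z * count_bound (\<lambda>t. f t + (case t of Leaf s \<Rightarrow> 0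
      | Node y z \<Rightarrow> if z = x then f y else 0) + h t) g y \<le> ?B + g z * ?B"
    by (intro add_mono mult_le_mono2)
  then show ?case using mult_le_mono2[OF Node(1), of "g z"]
    by (cases "z = x") (simp_all add: add_mult_distrib)
qed auto

lemma count_push: "count_list (push w v) t \<le> count_bound (count_list w) (count_list v) t"
proof (induction v arbitrary: w)
  case Nil
  then show ?case by (simp add: count_bound_ge)
next
  case (Cons x v)
  have "count_list (push w (x # v)) t \<le> count_bound (count_list (push1 w x)) (count_list v) t"
    using Cons by simp
  also have "\<dots> \<le> count_bound (\<lambda>t. count_list w t + 0) (\<lambda>z. count_list v z + (if z = x then 1 else 0)) t"
    using count_bound_shift[of "count_list w" x "\<lambda>_. 0" "count_list v" t]
    by (simp add: count_push1[abs_def])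
  also have "\<dots> \<le> count_bound (count_list w) (count_list (x # v)) t"
    by (rule count_bound_mono) auto
  finally show ?case .
qed

text \<open>The words \<open>comm1 y v\<close> are disjoint segments of \<open>push w v\<close>, and
  each of them is conjugated by a suffix of \<open>w\<close>. So the count is at most that of
  pushing \<open>push w v\<close> through \<open>w\<close>.\<close>

lemma count_commw: "count_list (commw w v) t \<le> count_bound (count_list (push w v)) (count_list w) t"
proof (induction w)
  case Nil then show ?case by simp
next
  case (Cons y w)
  have "count_list (commw (y # w) v) t
      \<le> count_bound (count_list (comm1 y v)) (count_list w) t + count_bound (count_list (push w v)) (count_list w) t"
    using Cons count_push[of "comm1 y v" w t] by simp
  also have "\<dots> = count_bound (\<lambda>t. count_list (comm1 y v) t + count_list (push w v) t) (count_list w) t"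
    by (simp add: count_bound_add)
  also have "\<dots> \<le> count_bound (count_list (push (y # w) v)) (count_list (y # w)) t"
    by (rule count_bound_mono) (auto simp: push_Cons_left)
  finally show ?case .
qed

text \<open>Letters of \<open>w\<close> enter \<open>acc\<close> one by one, so the bound starts
  from the counts of both words; what crosses are occurrences of \<open>x\<close> in
  \<open>w\<close>.\<close>

lemma count_collect: "count_list (collect x acc w) t
   \<le> count_bound (\<lambda>t. count_list acc t + count_list w t) (count_list w) t"
proof (induction w arbitrary: acc)
  case Nil
  then show ?case using count_bound_ge[of "count_list acc" t "\<lambda>_. 0"] by (simp add: count_bound_ge)
next
  case (Cons y w)
  show ?case
  proof (cases "y = x")
    case True
    have "count_list (collect x acc (y # w)) t
        \<le> count_bound (\<lambda>t. count_list (push1 acc x) t + count_list w t) (count_list w) t"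
      using Cons True by simp
    also have "\<dots> \<le> count_bound (\<lambda>t. count_list acc t + count_list w t)
                       (\<lambda>z. count_list w z + (if z = x then 1 else 0)) t"
      using count_bound_shift[of "count_list acc" x "count_list w" "count_list w" t]
      by (simp add: count_push1[abs_def])
    also have "\<dots> \<le> count_bound (\<lambda>t. count_list acc t + count_list (y # w) t) (count_list (y # w)) t"
      using True by (intro count_bound_mono) auto
    finally show ?thesis .
  next
    case False
    have "count_list (collect x acc (y # w)) t
        \<le> count_bound (\<lambda>t. count_list (acc @ [y]) t + count_list w t) (count_list w) t"
      using Cons.IH[of "acc @ [y]"] False by (simp only: collect.simps if_False)
    also have "\<dots> \<le> count_bound (\<lambda>t. count_list acc t + count_list (y # w) t) (count_list (y # w)) t"
      by (rule count_bound_mono) simp_all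
    finally show ?thesis .
  qed
qed

section \<open>Number of leaves of the letters that arise\<close>

definition built_on :: "'a set \<Rightarrow> nat \<Rightarrow> 'a ctree list \<Rightarrow> bool" where
  "built_on A q w \<longleftrightarrow> (\<forall>t\<in>set w. set_ctree t \<subseteq> A \<and> q \<le> csize t)"

lemma built_on_simps [simp]: "built_on A q []" "built_on A q (t # w) \<longleftrightarrow> set_ctree t \<subseteq> A \<and> q \<le> csize t \<and> built_on A q w"
  "built_on A q (w @ w') \<longleftrightarrow> built_on A q w \<and> built_on A q w'"
  by (auto simp: built_on_def)

lemma built_on_mono: "built_on A q w \<Longrightarrow> q' \<le> q \<Longrightarrow> built_on A q' w"
  by (auto simp: built_on_def)

lemma built_on_push1: "built_on A q w \<Longrightarrow> set_ctree x \<subseteq> A \<Longrightarrow> built_on A q (push1 w x)"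
  by (induction w) auto

lemma built_on_push: "built_on A q w \<Longrightarrow> built_on A 0 v \<Longrightarrow> built_on A q (push w v)"
  by (induction v arbitrary: w) (auto simp: built_on_push1)

lemma built_on_comm1: "set_ctree y \<subseteq> A \<Longrightarrow> p \<le> csize y \<Longrightarrow> built_on A q v \<Longrightarrow> built_on A (p + q) (comm1 y v)"
  by (induction v) (auto intro!: built_on_push intro: built_on_mono)

lemma built_on_commw: "built_on A p w \<Longrightarrow> built_on A q v \<Longrightarrow> built_on A (p + q) (commw w v)"
  by (induction w) (auto intro!: built_on_push built_on_comm1 intro: built_on_mono)

text \<open>A new letter has more leaves than some letter of \<open>w\<close>, hence more than q, so
  a tree with at most q leaves is never created.\<close>

lemma count_push_small:
  "built_on A q w \<Longrightarrow> csize c \<le> q \<Longrightarrow> built_on A 0 v \<Longrightarrow> count_list (push w v) c = count_list w c"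
proof (induction v arbitrary: w)
  case (Cons x v)
  have "count_list (push1 w x) c = count_list w c"
  proof (cases c)
    case (Node y z)
    have "csize y < q" using Cons.prems(2) csize_pos[of z] unfolding Node csize.simps by linarith
    then have "y \<notin> set w" using Cons.prems(1) by (auto simp: built_on_def)
    then show ?thesis by (auto simp: count_push1 Node count_notin)
  qed (auto simp: count_push1)
  then show ?case using Cons by (auto simp: built_on_push1)
qed simp

lemma count_comm1_small:
  assumes "set_ctree y \<subseteq> A" "csize x0 \<le> csize y" "built_on A (csize y0) v"
  shows "count_list (comm1 y v) (Node x0 y0) = (if y = x0 then count_list v y0 else 0)"
  using assms
proof (induction v)
  case (Cons x v)
  have "count_list (push [Node y x] v) (Node x0 y0) = count_list [Node y x] (Node x0 y0)"
    by (rule count_push_small[of A "csize x0 + csize y0"])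
      (use Cons.prems in \<open>auto intro!: built_on_mono[of A "csize y0" v] simp: Suc_leI\<close>)
  then show ?case using Cons by auto
qed simp

text \<open>To leading order the commutator is bilinear: [x0, y0] arises once for each pair of an
  occurrence of x0 in \<open>w\<close> and of y0 in \<open>v\<close>, because any further crossing
  adds leaves. The count must be exact since it becomes an exponent.\<close>

lemma count_commw_small:
  assumes "built_on A (csize x0) w" "built_on A (csize y0) v"
  shows "count_list (commw w v) (Node x0 y0) = count_list w x0 * count_list v y0"
  using assms
proof (induction w)
  case (Cons y w)
  have "count_list (push (comm1 y v) w) (Node x0 y0) = count_list (comm1 y v) (Node x0 y0)"
    by (rule count_push_small[of A "csize x0 + csize y0"])
      (use Cons.prems csize_pos[of y0] csize_pos[of x0] in \<open>auto intro!: built_on_comm1 intro: built_on_mono simp: Suc_leI\<close>)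
  then show ?case using Cons count_comm1_small[of y A x0 y0 v] by auto
qed simp

lemma set_push_cases:
  "t \<in> set (push w v) \<Longrightarrow> t \<in> set w \<or> (\<exists>y\<in>set w. csize y < csize t)"
proof (induction v arbitrary: w)
  case (Cons x v)
  have *: "t \<in> set w \<or> (\<exists>y\<in>set w. csize y < csize t)" if t: "t \<in> set (push1 w x)" for t
  proof (cases "t \<in> set w")
    case False
    then obtain y where "y \<in> set w" "t = Node y x" using t by (auto simp: push1_def)
    then show ?thesis by (auto intro!: bexI[of _ y])
  qed simp
  have "t \<in> set (push1 w x) \<or> (\<exists>y\<in>set (push1 w x). csize y < csize t)"
    using Cons by simp
  then show ?case using * by (meson less_trans)
qed simp

lemma set_comm1_cases:
  "t \<in> set (comm1 y v) \<Longrightarrow> \<exists>x\<in>set v. t = Node y x \<or> csize y + csize x < csize t"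
proof (induction v)
  case (Cons x v)
  then show ?case using set_push_cases[of t "[Node y x]" v] by auto
qed simp

lemma set_commw_cases:
  "t \<in> set (commw w v) \<Longrightarrow> \<exists>y\<in>set w. \<exists>x\<in>set v. t = Node y x \<or> csize y + csize x < csize t"
proof (induction w)
  case (Cons y w)
  consider "t \<in> set (push (comm1 y v) w)" | "t \<in> set (commw w v)" using Cons by auto
  then show ?case
  proof cases
    case 1
    then obtain z where z: "z \<in> set (comm1 y v)" "t = z \<or> csize z < csize t"
      using set_push_cases by blast
    then obtain x where "x \<in> set v" "z = Node y x \<or> csize y + csize x < csize z"
      using set_comm1_cases by blast
    then have "t = Node y x \<or> csize y + csize x < csize t" using z(2) by auto
    then show ?thesis using \<open>x \<in> set v\<close> by auto
  qed (use Cons in auto)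
qed simp

lemma set_collect_cases:
  "t \<in> set (collect x acc w) \<Longrightarrow> t \<in> set acc \<union> (set w - {x}) \<or> csize x < csize t"
proof (induction w arbitrary: acc)
  case (Cons y w)
  have *: "t \<in> set acc \<or> csize x < csize t" if "t \<in> set (push1 acc x)"
    using that by (force simp: push1_def)
  show ?case using Cons.IH[of "push1 acc x"] Cons.IH[of "acc @ [y]"] Cons.prems *
    by (auto split: if_splits)
qed simp

lemma built_on_collect: "built_on A q acc \<Longrightarrow> built_on A q w \<Longrightarrow> set_ctree x \<subseteq> A \<Longrightarrow> built_on A q (collect x acc w)"
  by (induction w arbitrary: acc) (auto simp: built_on_push1)

section \<open>Evaluation in a group\<close>

primrec cval :: "('a, 'b) monoid_scheme \<Rightarrow> 'a ctree \<Rightarrow> 'a" where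
  "cval G (Leaf s) = s"
| "cval G (Node x y) = inv\<^bsub>G\<^esub> (cval G x) \<otimes>\<^bsub>G\<^esub> inv\<^bsub>G\<^esub> (cval G y) \<otimes>\<^bsub>G\<^esub> cval G x \<otimes>\<^bsub>G\<^esub> cval G y"

definition wval :: "('a, 'b) monoid_scheme \<Rightarrow> 'a ctree list \<Rightarrow> 'a" where
  "wval G w = list_prod G (map (cval G) w)"

text \<open>Words carry no formal inverses: leaves are inverted in the group, and [x, y]^-1 =
  [y, x].\<close>

primrec cinv :: "('a, 'b) monoid_scheme \<Rightarrow> 'a ctree \<Rightarrow> 'a ctree" where
  "cinv G (Leaf s) = Leaf (inv\<^bsub>G\<^esub> s)"
| "cinv G (Node x y) = Node y x"

lemma csize_cinv [simp]: "csize (cinv G t) = csize t"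
  by (cases t) auto

lemma list_prod_simps [simp]: "list_prod G [] = \<one>\<^bsub>G\<^esub>"
  "list_prod G (x # xs) = x \<otimes>\<^bsub>G\<^esub> list_prod G xs"
  by (auto simp: list_prod_def)

lemma wval_simps [simp]: "wval G [] = \<one>\<^bsub>G\<^esub>"
  "wval G (x # xs) = cval G x \<otimes>\<^bsub>G\<^esub> wval G xs"
  by (auto simp: wval_def)

context group
begin

lemma list_prod_closed [intro]: "set xs \<subseteq> carrier G \<Longrightarrow> list_prod G xs \<in> carrier G"
  by (induction xs) auto

lemma list_prod_append: "set xs \<subseteq> carrier G \<Longrightarrow> set ys \<subseteq> carrier G \<Longrightarrow>
    list_prod G (xs @ ys) = list_prod G xs \<otimes> list_prod G ys"
  by (induction xs) (auto simp: m_assoc list_prod_closed)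

lemma inv_list_prod: "set xs \<subseteq> carrier G \<Longrightarrow>
    inv (list_prod G xs) = list_prod G (rev (map (m_inv G) xs))"
proof (induction xs)
  case (Cons x xs)
  have "list_prod G (rev (map (m_inv G) xs) @ [inv x])
      = list_prod G (rev (map (m_inv G) xs)) \<otimes> list_prod G [inv x]"
    using Cons.prems by (intro list_prod_append) auto
  then show ?case using Cons by (simp add: inv_mult_group list_prod_closed)
qed simp

lemma cval_closed [intro]: "set_ctree t \<subseteq> carrier G \<Longrightarrow> cval G t \<in> carrier G"
  by (induction t) auto

lemma wval_closed [intro]: "built_on (carrier G) 0 w \<Longrightarrow> wval G w \<in> carrier G"
  by (induction w) auto

lemma wval_append: "built_on (carrier G) 0 w \<Longrightarrow> built_on (carrier G) 0 v \<Longrightarrow> wval G (w @ v) = wval G w \<otimes> wval G v"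
  by (induction w) (auto simp: m_assoc cval_closed wval_closed)

lemma mult_inv_cancel_left [simp]: "x \<in> carrier G \<Longrightarrow> y \<in> carrier G \<Longrightarrow> x \<otimes> (inv x \<otimes> y) = y"
  by (simp add: m_assoc[symmetric])

lemma inv_mult_cancel_left [simp]: "x \<in> carrier G \<Longrightarrow> y \<in> carrier G \<Longrightarrow> inv x \<otimes> (x \<otimes> y) = y"
  by (simp add: m_assoc[symmetric])

lemma wval_push1:
  assumes "built_on (carrier G) 0 w" "set_ctree x \<subseteq> carrier G"
  shows "wval G w \<otimes> cval G x = cval G x \<otimes> wval G (push1 w x)"
  using assms
proof (induction w)
  case (Cons y w)
  note [simp] = cval_closed wval_closed built_on_push1
  have c: "cval G y \<in> carrier G" "cval G x \<in> carrier G" "wval G (push1 w x) \<in> carrier G"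
    "wval G w \<in> carrier G"
    using Cons.prems built_on_push1[of "carrier G" 1 w x] by auto
  have "wval G (y # w) \<otimes> cval G x = cval G y \<otimes> (wval G w \<otimes> cval G x)"
    using c by (simp add: m_assoc)
  also have "\<dots> = cval G y \<otimes> (cval G x \<otimes> wval G (push1 w x))" using Cons by simp
  also have "\<dots> = cval G x \<otimes> wval G (push1 (y # w) x)" using c by (simp add: m_assoc)
  finally show ?case .
qed (auto simp: cval_closed)

lemma wval_push:
  assumes "built_on (carrier G) 0 w" "built_on (carrier G) 0 v"
  shows "wval G w \<otimes> wval G v = wval G v \<otimes> wval G (push w v)"
  using assms
proof (induction v arbitrary: w)
  case (Cons x v)
  have o: "built_on (carrier G) 0 (push1 w x)" using Cons.prems by (auto intro: built_on_push1)
  have c: "cval G x \<in> carrier G" "wval G (push1 w x) \<in> carrier G"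
    "wval G w \<in> carrier G" "wval G v \<in> carrier G" "wval G (push (push1 w x) v) \<in> carrier G"
    using Cons.prems o built_on_push[OF o, of v] by auto
  have "wval G w \<otimes> wval G (x # v) = (wval G w \<otimes> cval G x) \<otimes> wval G v"
    using c by (simp add: m_assoc)
  also have "\<dots> = cval G x \<otimes> (wval G (push1 w x) \<otimes> wval G v)"
    using c Cons.prems by (simp add: wval_push1 m_assoc)
  also have "\<dots> = cval G x \<otimes> (wval G v \<otimes> wval G (push (push1 w x) v))"
    using Cons.IH[OF o] Cons.prems by simp
  also have "\<dots> = wval G (x # v) \<otimes> wval G (push w (x # v))" using c by (simp add: m_assoc)
  finally show ?case .
qed (auto simp: wval_closed)

lemma wval_comm1:
  assumes "set_ctree y \<subseteq> carrier G" "built_on (carrier G) 0 v"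
  shows "wval G (comm1 y v) = inv (cval G y) \<otimes> inv (wval G v) \<otimes> cval G y \<otimes> wval G v"
proof -
  have "built_on (carrier G) (0+0) (comm1 y v)" using assms by (intro built_on_comm1) auto
  then have c: "cval G y \<in> carrier G" "wval G v \<in> carrier G" "wval G (comm1 y v) \<in> carrier G"
    using assms by auto
  have "cval G y \<otimes> wval G v = wval G v \<otimes> (cval G y \<otimes> wval G (comm1 y v))"
    using wval_push[of "[y]" v] assms c by (simp add: push_single)
  then have "inv (cval G y) \<otimes> (inv (wval G v) \<otimes> (cval G y \<otimes> wval G v))
      = inv (cval G y) \<otimes> (inv (wval G v) \<otimes> (wval G v \<otimes> (cval G y \<otimes> wval G (comm1 y v))))" by simp
  then show ?thesis using c by (simp add: m_assoc)
qed

lemma wval_commw: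
  assumes "built_on (carrier G) 0 w" "built_on (carrier G) 0 v"
  shows "wval G (commw w v) = inv (wval G w) \<otimes> inv (wval G v) \<otimes> wval G w \<otimes> wval G v"
  using assms
proof (induction w)
  case Nil
  then show ?case by (auto simp: wval_closed)
next
  case (Cons y w)
  have o1: "built_on (carrier G) 0 (comm1 y v)"
    using Cons.prems by (intro built_on_mono[OF built_on_comm1[of y "carrier G" 0 0 v]]) auto
  have o2: "built_on (carrier G) 0 (commw w v)"
    using Cons.prems by (intro built_on_mono[OF built_on_commw[of "carrier G" 0 w 0 v]]) auto
  have o3: "built_on (carrier G) 0 (push (comm1 y v) w)" using o1 Cons.prems by (intro built_on_push) auto
  have c: "cval G y \<in> carrier G" "wval G v \<in> carrier G" "wval G w \<in> carrier G"
    "wval G (push (comm1 y v) w) \<in> carrier G" "wval G (comm1 y v) \<in> carrier G"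
    using o1 o2 o3 Cons.prems by auto
  have "wval G (push (comm1 y v) w) = inv (wval G w) \<otimes> (wval G w \<otimes> wval G (push (comm1 y v) w))"
    using c by simp
  also have "\<dots> = inv (wval G w) \<otimes> (wval G (comm1 y v) \<otimes> wval G w)"
    using wval_push[OF o1, of w] Cons.prems by simp
  finally have p: "wval G (push (comm1 y v) w) = inv (wval G w) \<otimes> (wval G (comm1 y v) \<otimes> wval G w)" .
  have "wval G (commw (y # w) v) = wval G (push (comm1 y v) w) \<otimes> wval G (commw w v)"
    using o2 o3 by (simp add: wval_append)
  then show ?case using c Cons by (simp add: p wval_comm1 m_assoc inv_mult_group)
qed

lemma wval_collect:
  assumes "built_on (carrier G) 0 acc" "built_on (carrier G) 0 w" "set_ctree x \<subseteq> carrier G"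
  shows "wval G acc \<otimes> wval G w = cval G x [^] count_list w x \<otimes> wval G (collect x acc w)"
  using assms
proof (induction w arbitrary: acc)
  case Nil
  then show ?case by (auto simp: wval_closed)
next
  case (Cons y w)
  show ?case
  proof (cases "y = x")
    case True
    have o: "built_on (carrier G) 0 (push1 acc x)" using Cons.prems by (auto intro: built_on_push1)
    have o2: "built_on (carrier G) 0 (collect x (push1 acc x) w)"
      using o Cons.prems by (auto intro: built_on_collect)
    have c: "cval G x \<in> carrier G" "wval G w \<in> carrier G" "wval G acc \<in> carrier G"
       "wval G (push1 acc x) \<in> carrier G" "wval G (collect x (push1 acc x) w) \<in> carrier G"
      using Cons.prems o o2 by auto
    have "wval G acc \<otimes> wval G (y # w) = (wval G acc \<otimes> cval G x) \<otimes> wval G w"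
      using c True by (simp add: m_assoc)
    also have "\<dots> = cval G x \<otimes> (wval G (push1 acc x) \<otimes> wval G w)"
      using c Cons.prems by (simp add: wval_push1 m_assoc)
    also have "\<dots> = cval G x \<otimes> (cval G x [^] count_list w x \<otimes> wval G (collect x (push1 acc x) w))"
      using Cons.IH[OF o] Cons.prems by simp
    also have "\<dots> = cval G x [^] Suc (count_list w x) \<otimes> wval G (collect x (push1 acc x) w)"
      using c by (metis m_assoc nat_pow_Suc2 nat_pow_closed)
    finally show ?thesis using True by simp
  next
    case False
    have "wval G acc \<otimes> wval G (y # w) = wval G (acc @ [y]) \<otimes> wval G w"
      using Cons.prems by (simp add: wval_append m_assoc wval_closed cval_closed)
    then show ?thesis using Cons False by simp
  qed
qed

lemma cval_cinv: "set_ctree t \<subseteq> carrier G \<Longrightarrow> cval G (cinv G t) = inv (cval G t)"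
  by (cases t) (auto simp: inv_mult_group m_assoc cval_closed)

lemma wval_rev_cinv:
  assumes "built_on (carrier G) 0 w"
  shows "wval G (rev (map (cinv G) w)) = inv (wval G w)"
proof -
  have "map (m_inv G) (map (cval G) w) = map (cval G) (map (cinv G) w)"
    using assms by (auto simp: built_on_def cval_cinv)
  moreover have "set (map (cval G) w) \<subseteq> carrier G"
    using assms by (auto simp: built_on_def cval_closed)
  ultimately show ?thesis unfolding wval_def by (metis inv_list_prod rev_map)
qed

end

section \<open>Bounded products of powers in nilpotent groups\<close>

definition power_prod :: "('a, 'b) monoid_scheme \<Rightarrow> ('a \<times> nat) list \<Rightarrow> 'a" where
  "power_prod G ps = list_prod G (map (\<lambda>(s, n). s [^]\<^bsub>G\<^esub> n) ps)"

lemma power_prod_simps [simp]: "power_prod G [] = \<one>\<^bsub>G\<^esub>"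
  "power_prod G ((s, n) # ps) = s [^]\<^bsub>G\<^esub> n \<otimes>\<^bsub>G\<^esub> power_prod G ps"
  by (auto simp: power_prod_def)

lemma (in group) power_prod_closed: "fst ` set ps \<subseteq> carrier G \<Longrightarrow> power_prod G ps \<in> carrier G"
  by (induction ps) auto

lemma (in group) power_prod_append:
  "fst ` set ps \<subseteq> carrier G \<Longrightarrow> fst ` set qs \<subseteq> carrier G \<Longrightarrow>
    power_prod G (ps @ qs) = power_prod G ps \<otimes> power_prod G qs"
  by (induction ps) (auto simp: m_assoc power_prod_closed)

lemma (in group) power_prod_inv:
  assumes "fst ` set ps \<subseteq> carrier G"
  shows "power_prod G (rev (map (\<lambda>(s, n). (inv s, n)) ps)) = inv (power_prod G ps)"
  using assms
proof (induction ps)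
  case (Cons p ps)
  obtain s n where p: "p = (s, n)" by force
  have "power_prod G (rev (map (\<lambda>(s, n). (inv s, n)) ps) @ [(inv s, n)])
     = power_prod G (rev (map (\<lambda>(s, n). (inv s, n)) ps)) \<otimes> power_prod G [(inv s, n)]"
    using Cons.prems p by (intro power_prod_append) auto
  then show ?case using Cons p by (simp add: inv_mult_group power_prod_closed nat_pow_inv)
qed simp

text \<open>The index i will be a word and \<open>wt i\<close> its letter counts, so that one
  statement about a family is a statement uniform in all words. Closure of \<open>A\<close> under
  inverses makes up for the absence of formal inverses.\<close>

locale weighted_family = group G for G (structure) +
  fixes A :: "'a set" and wt :: "'i \<Rightarrow> 'a \<Rightarrow> nat"
  assumes A_carrier: "A \<subseteq> carrier G" and A_finite: "finite A"
    and A_inv: "s \<in> A \<Longrightarrow> inv s \<in> A"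
    and wt_pos: "s \<in> A \<Longrightarrow> 1 \<le> wt i s"
    and wt_inv: "s \<in> A \<Longrightarrow> wt i (inv s) = wt i s"
begin

text \<open>The constants below may depend on the formal commutator, but not on the index \<open>i\<close>.\<close>

definition weighted_words :: "nat \<Rightarrow> ('i \<Rightarrow> 'a) \<Rightarrow> bool" where
  "weighted_words q g \<longleftrightarrow> (\<exists>C. \<forall>i. \<exists>w. built_on A q w \<and> (\<forall>t. count_list w t \<le> C t * cwt (wt i) t) \<and> wval G w = g i)"

definition power_products :: "('i \<Rightarrow> 'a) \<Rightarrow> bool" where
  "power_products g \<longleftrightarrow> (\<exists>Q. \<forall>i. \<exists>ps. length ps \<le> Q \<and> (\<forall>(s, n)\<in>set ps. s \<in> A \<and> n \<le> wt i s)
     \<and> g i = power_prod G ps)"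

text \<open>Congruence modulo commutators with at least q leaves: g = U r, where the error r is
  again a weighted word, so its letter counts remain under control for the next round.\<close>

definition power_products_mod :: "nat \<Rightarrow> ('i \<Rightarrow> 'a) \<Rightarrow> bool" where
  "power_products_mod q g \<longleftrightarrow> (\<exists>U. power_products U \<and> weighted_words q (\<lambda>i. inv (U i) \<otimes> g i))"

lemma built_on_carrier: "built_on A q w \<Longrightarrow> built_on (carrier G) 0 w"
  using A_carrier by (auto simp: built_on_def)

lemma weighted_wordsI:
  assumes "\<And>i. built_on A q (w i)" "\<And>i t. count_list (w i) t \<le> C t * cwt (wt i) t" "\<And>i. wval G (w i) = g i"
  shows "weighted_words q g"
  unfolding weighted_words_def using assms by blast

lemma weighted_wordsE:
  assumes "weighted_words q g"
  obtains w C where "\<And>i. built_on A q (w i)" "\<And>i t. count_list (w i) t \<le> C t * cwt (wt i) t" "\<And>i. wval G (w i) = g i"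
    "\<And>i. built_on (carrier G) 0 (w i)"
proof -
  from assms obtain C where "\<forall>i. \<exists>w. built_on A q w \<and> (\<forall>t. count_list w t \<le> C t * cwt (wt i) t) \<and> wval G w = g i"
    unfolding weighted_words_def by blast
  then obtain w where "\<forall>i. built_on A q (w i) \<and> (\<forall>t. count_list (w i) t \<le> C t * cwt (wt i) t) \<and> wval G (w i) = g i"
    by metis
  then show thesis using that[of w C] built_on_carrier by blast
qed

lemma weighted_words_closed: "weighted_words q g \<Longrightarrow> g i \<in> carrier G"
  by (elim weighted_wordsE) (metis wval_closed)

lemma weighted_words_one: "weighted_words q (\<lambda>i. \<one>)"
  by (rule weighted_wordsI[of q "\<lambda>_. []" "\<lambda>_. 0"]) auto

lemma weighted_words_mult:
  assumes "weighted_words q g" "weighted_words q h"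
  shows "weighted_words q (\<lambda>i. g i \<otimes> h i)"
proof -
  obtain w C where w: "\<And>i. built_on A q (w i)" "\<And>i t. count_list (w i) t \<le> C t * cwt (wt i) t"
    "\<And>i. wval G (w i) = g i" "\<And>i. built_on (carrier G) 0 (w i)" using assms(1) by (rule weighted_wordsE) blast
  obtain v C' where v: "\<And>i. built_on A q (v i)" "\<And>i t. count_list (v i) t \<le> C' t * cwt (wt i) t"
    "\<And>i. wval G (v i) = h i" "\<And>i. built_on (carrier G) 0 (v i)" using assms(2) by (rule weighted_wordsE) blast
  show ?thesis
    by (rule weighted_wordsI[of q "\<lambda>i. w i @ v i" "\<lambda>t. C t + C' t"])
      (use w v in \<open>auto simp: wval_append add_mult_distrib intro: add_mono\<close>)
qed

lemma set_ctree_cinv: "set_ctree t \<subseteq> A \<Longrightarrow> set_ctree (cinv G t) \<subseteq> A"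
  by (cases t) (auto simp: A_inv)

lemma cinv_cinv: "set_ctree t \<subseteq> A \<Longrightarrow> cinv G (cinv G t) = t"
  using A_carrier by (cases t) auto

lemma cwt_cinv: "set_ctree t \<subseteq> A \<Longrightarrow> cwt (wt i) (cinv G t) = cwt (wt i) t"
  by (cases t) (auto simp: wt_inv)

lemma count_map_cinv:
  assumes "built_on A q w" "set_ctree t \<subseteq> A"
  shows "count_list (map (cinv G) w) t = count_list w (cinv G t)"
  using assms(1)
proof (induction w)
  case (Cons y w)
  have "cinv G y = t \<longleftrightarrow> y = cinv G t"
    using cinv_cinv[OF assms(2)] cinv_cinv[of y] Cons.prems by auto
  then show ?case using Cons by simp
qed simp

lemma weighted_words_inv:
  assumes "weighted_words q g"
  shows "weighted_words q (\<lambda>i. inv (g i))"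
proof -
  obtain w C where w: "\<And>i. built_on A q (w i)" "\<And>i t. count_list (w i) t \<le> C t * cwt (wt i) t"
    "\<And>i. wval G (w i) = g i" "\<And>i. built_on (carrier G) 0 (w i)" using assms(1) by (rule weighted_wordsE) blast
  have b: "built_on A q (rev (map (cinv G) (w i)))" for i
    using w(1)[of i] set_ctree_cinv by (auto simp: built_on_def)
  show ?thesis
  proof (rule weighted_wordsI[of q "\<lambda>i. rev (map (cinv G) (w i))" "\<lambda>t. C (cinv G t)"])
    fix i t
    show "count_list (rev (map (cinv G) (w i))) t \<le> C (cinv G t) * cwt (wt i) t"
    \<comment> \<open>For trees outside \<open>A\<close>, \<open>cinv\<close> need not be an
      involution; such trees do not occur at all.\<close>
    proof (cases "set_ctree t \<subseteq> A")
      case True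
      then show ?thesis
        using count_map_cinv[OF w(1) True, of i] w(2)[of i "cinv G t"] by (simp add: cwt_cinv)
    next
      case False
      then have "t \<notin> set (rev (map (cinv G) (w i)))" using b[of i] unfolding built_on_def by blast
      then have "count_list (rev (map (cinv G) (w i))) t = 0" by (rule count_notin)
      then show ?thesis by linarith
    qed
  qed (use b w in \<open>auto simp: wval_rev_cinv\<close>)
qed

text \<open>Crossings only add larger trees, so q is kept even if \<open>h\<close> consists of
  single generators.\<close>

lemma weighted_words_conj:
  assumes "weighted_words q g" "weighted_words 0 h"
  shows "weighted_words q (\<lambda>i. inv (h i) \<otimes> g i \<otimes> h i)"
proof -
  obtain w C where w: "\<And>i. built_on A q (w i)" "\<And>i t. count_list (w i) t \<le> C t * cwt (wt i) t"
    "\<And>i. wval G (w i) = g i" "\<And>i. built_on (carrier G) 0 (w i)" using assms(1) by (rule weighted_wordsE) blast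
  obtain v C' where v: "\<And>i. built_on A 0 (v i)" "\<And>i t. count_list (v i) t \<le> C' t * cwt (wt i) t"
    "\<And>i. wval G (v i) = h i" "\<And>i. built_on (carrier G) 0 (v i)" using assms(2) by (rule weighted_wordsE) blast
  show ?thesis
  proof (rule weighted_wordsI[of q "\<lambda>i. push (w i) (v i)" "\<lambda>t. count_bound C C' t"])
    fix i t
    have "count_list (push (w i) (v i)) t \<le> count_bound (\<lambda>t. C t * cwt (wt i) t) (\<lambda>t. C' t * cwt (wt i) t) t"
      by (rule order_trans[OF count_push]) (intro count_bound_mono w v)
    then show "count_list (push (w i) (v i)) t \<le> count_bound C C' t * cwt (wt i) t" by (simp add: count_bound_cwt)
  next
    fix i
    show "built_on A q (push (w i) (v i))" using w v by (intro built_on_push)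
    then have c: "wval G (push (w i) (v i)) \<in> carrier G" "g i \<in> carrier G" "h i \<in> carrier G"
      using built_on_carrier assms weighted_words_closed by blast+
    have "g i \<otimes> h i = h i \<otimes> wval G (push (w i) (v i))" using wval_push[OF w(4) v(4), of i i] w v by simp
    then have "inv (h i) \<otimes> (g i \<otimes> h i) = inv (h i) \<otimes> (h i \<otimes> wval G (push (w i) (v i)))" by simp
    then show "wval G (push (w i) (v i)) = inv (h i) \<otimes> g i \<otimes> h i" using c by (simp add: m_assoc)
  qed
qed

lemma power_productsE:
  assumes "power_products g"
  obtains Q ps where "\<And>i. length (ps i) \<le> Q" "\<And>i s n. (s, n) \<in> set (ps i) \<Longrightarrow> s \<in> A \<and> n \<le> wt i s"
    "\<And>i. g i = power_prod G (ps i)" "\<And>i. fst ` set (ps i) \<subseteq> carrier G"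
proof -
  from assms obtain Q where "\<forall>i. \<exists>ps. length ps \<le> Q \<and> (\<forall>(s, n)\<in>set ps. s \<in> A \<and> n \<le> wt i s)
     \<and> g i = power_prod G ps" unfolding power_products_def by blast
  from choice[OF this] obtain ps where ps: "\<forall>i. length (ps i) \<le> Q \<and> (\<forall>(s, n)\<in>set (ps i). s \<in> A \<and> n \<le> wt i s)
     \<and> g i = power_prod G (ps i)" by (elim exE)
  have "fst ` set (ps i) \<subseteq> carrier G" for i using ps A_carrier by (auto dest!: spec[of _ i])
  then show thesis by (intro that[of ps Q]) (use ps in auto)
qed

lemma power_productsI:
  assumes "\<And>i. length (ps i) \<le> Q" "\<And>i s n. (s, n) \<in> set (ps i) \<Longrightarrow> s \<in> A \<and> n \<le> wt i s"
    "\<And>i. g i = power_prod G (ps i)"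
  shows "power_products g"
  unfolding power_products_def
proof (intro exI[of _ Q] allI)
  fix i
  show "\<exists>ps. length ps \<le> Q \<and> (\<forall>(s, n)\<in>set ps. s \<in> A \<and> n \<le> wt i s) \<and> g i = power_prod G ps"
    using assms by (intro exI[of _ "ps i"]) auto
qed

lemma power_products_one: "power_products (\<lambda>i. \<one>)"
  by (rule power_productsI[of "\<lambda>_. []" 0]) auto

lemma power_products_mult:
  assumes "power_products g" "power_products h"
  shows "power_products (\<lambda>i. g i \<otimes> h i)"
proof -
  obtain ps Q where p: "\<And>i. length (ps i) \<le> Q" "\<And>i s n. (s, n) \<in> set (ps i) \<Longrightarrow> s \<in> A \<and> n \<le> wt i s"
    "\<And>i. g i = power_prod G (ps i)" "\<And>i. fst ` set (ps i) \<subseteq> carrier G" using assms(1) by (rule power_productsE) blast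
  obtain qs R where q: "\<And>i. length (qs i) \<le> R" "\<And>i s n. (s, n) \<in> set (qs i) \<Longrightarrow> s \<in> A \<and> n \<le> wt i s"
    "\<And>i. h i = power_prod G (qs i)" "\<And>i. fst ` set (qs i) \<subseteq> carrier G" using assms(2) by (rule power_productsE) blast
  show ?thesis
    by (rule power_productsI[of "\<lambda>i. ps i @ qs i" "Q + R"])
      (use p q in \<open>auto simp: power_prod_append intro: add_mono\<close>)
qed

lemma power_products_inv:
  assumes "power_products g"
  shows "power_products (\<lambda>i. inv (g i))"
proof -
  obtain ps Q where p: "\<And>i. length (ps i) \<le> Q" "\<And>i s n. (s, n) \<in> set (ps i) \<Longrightarrow> s \<in> A \<and> n \<le> wt i s"
    "\<And>i. g i = power_prod G (ps i)" "\<And>i. fst ` set (ps i) \<subseteq> carrier G" using assms(1) by (rule power_productsE) blast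
  show ?thesis
    by (rule power_productsI[of "\<lambda>i. rev (map (\<lambda>(s, n). (inv s, n)) (ps i))" Q])
      (use p in \<open>auto simp: power_prod_inv A_inv wt_inv\<close>)
qed

lemma power_products_closed: "power_products g \<Longrightarrow> g i \<in> carrier G"
  by (elim power_productsE) (metis power_prod_closed)

lemma power_products_power:
  assumes "s \<in> A" "\<And>i. n i \<le> C * wt i s"
  shows "power_products (\<lambda>i. s [^] (n i :: nat))"
  using assms(2)
proof (induction C arbitrary: n)
  case 0
  then show ?case by (simp add: power_products_one)
next
  case (Suc C)
  have "power_products (\<lambda>i. s [^] min (n i) (wt i s))"
    by (rule power_productsI[of "\<lambda>i. [(s, min (n i) (wt i s))]" 1]) (use assms A_carrier in auto)
  moreover have "power_products (\<lambda>i. s [^] (n i - min (n i) (wt i s)))"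
    using Suc.prems by (intro Suc.IH) (auto simp: min_def le_diff_conv add.commute)
  ultimately have "power_products (\<lambda>i. s [^] min (n i) (wt i s) \<otimes> s [^] (n i - min (n i) (wt i s)))"
    by (rule power_products_mult)
  moreover have "s \<in> carrier G" using assms A_carrier by auto
  ultimately show ?case by (simp add: nat_pow_mult)
qed

lemma wval_replicate: "set_ctree t \<subseteq> carrier G \<Longrightarrow> wval G (replicate n t) = cval G t [^] n"
  by (induction n) (auto simp: nat_pow_Suc2[symmetric] cval_closed simp del: nat_pow_Suc)

lemma count_list_replicate [simp]: "count_list (replicate n x) y = (if x = y then n else 0)"
  by (induction n) auto

lemma built_on_replicate: "set_ctree t \<subseteq> A \<Longrightarrow> q \<le> csize t \<Longrightarrow> built_on A q (replicate n t)"
  by (auto simp: built_on_def)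

lemma power_products_weighted_words: 
  assumes "power_products g"
  shows "weighted_words 0 g"
proof -
  obtain ps Q where p: "\<And>i. length (ps i) \<le> Q" "\<And>i s n. (s, n) \<in> set (ps i) \<Longrightarrow> s \<in> A \<and> n \<le> wt i s"
    "\<And>i. g i = power_prod G (ps i)" "\<And>i. fst ` set (ps i) \<subseteq> carrier G" using assms(1) by (rule power_productsE) blast
  define f where "f = (\<lambda>ps. concat (map (\<lambda>(s, n). replicate n (Leaf s)) ps) :: 'a ctree list)"
  have *: "built_on A 0 (f qs) \<and> count_list (f qs) t \<le> length qs * cwt (wt i) t \<and> wval G (f qs) = power_prod G qs"
    if "\<And>s n. (s, n) \<in> set qs \<Longrightarrow> s \<in> A \<and> n \<le> wt i s" for qs i t
    using that
  proof (induction qs)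
    case (Cons p qs)
    obtain s n where pp: "p = (s, n)" by force
    have s: "s \<in> A" "n \<le> wt i s" using Cons.prems pp by auto
    have IH: "built_on A 0 (f qs)" "count_list (f qs) t \<le> length qs * cwt (wt i) t"
      "wval G (f qs) = power_prod G qs" using Cons by auto
    have f: "f ((s, n) # qs) = replicate n (Leaf s) @ f qs" by (simp add: f_def pp)
    have b: "built_on A 0 (replicate n (Leaf s))" using s by (intro built_on_replicate) auto
    have "wval G (f ((s, n) # qs)) = s [^] n \<otimes> power_prod G qs"
      using b IH s A_carrier unfolding f
      by (subst wval_append) (auto intro: built_on_carrier simp: wval_replicate subsetD)
    then show ?case using IH b s by (auto simp: f pp intro!: add_mono)
  qed (simp add: f_def)
  show ?thesis
  proof (rule weighted_wordsI[of 0 "\<lambda>i. f (ps i)" "\<lambda>_. Q"])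
    fix i t show "count_list (f (ps i)) t \<le> Q * cwt (wt i) t"
      using *[of "ps i" i t] p by (meson mult_le_mono1 order_trans)
  qed (use *[OF p(2)] p(3) in auto)
qed

text \<open>If g = U r and h = V s, then g h = U V (V^-1 r V) s, and the conjugate of r by the
  bounded product V is still built from trees with at least q leaves.\<close>

lemma power_products_mod_mult:
  assumes "power_products_mod q g" "power_products_mod q h" "\<And>i. g i \<in> carrier G" "\<And>i. h i \<in> carrier G"
  shows "power_products_mod q (\<lambda>i. g i \<otimes> h i)"
proof -
  obtain U V where U: "power_products U" "weighted_words q (\<lambda>i. inv (U i) \<otimes> g i)" and V: "power_products V" "weighted_words q (\<lambda>i. inv (V i) \<otimes> h i)"
    using assms unfolding power_products_mod_def by blast
  have "weighted_words q (\<lambda>i. inv (V i) \<otimes> (inv (U i) \<otimes> g i) \<otimes> V i \<otimes> (inv (V i) \<otimes> h i))"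
    using U V by (intro weighted_words_mult[OF weighted_words_conj] power_products_weighted_words)
  moreover have "inv (V i) \<otimes> (inv (U i) \<otimes> g i) \<otimes> V i \<otimes> (inv (V i) \<otimes> h i)
      = inv (U i \<otimes> V i) \<otimes> (g i \<otimes> h i)" for i
    using power_products_closed[OF U(1), of i] power_products_closed[OF V(1), of i] assms(3,4)[of i]
    by (simp add: m_assoc inv_mult_group)
  ultimately show ?thesis unfolding power_products_mod_def using power_products_mult[OF U(1) V(1)] by auto
qed

lemma power_products_mod_weighted_words: "weighted_words q g \<Longrightarrow> power_products_mod q g"
  unfolding power_products_mod_def using power_products_one weighted_words_closed[of q g] by (intro exI[of _ "\<lambda>i. \<one>"]) auto

lemma cwt_pos: "set_ctree t \<subseteq> A \<Longrightarrow> 1 \<le> cwt (wt i) t"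
  by (induction t) (use wt_pos in \<open>auto simp: Suc_le_eq\<close>)

text \<open>In the commutator word of x^a z1 and y^b z2 the tree [x, y] occurs exactly a b times;
  collecting these occurrences in front leaves r. The factors z1 and z2 are allowed because
  induction describes x^a and y^b only up to longer commutators.\<close>

lemma weighted_words_comm_power:
  assumes x: "set_ctree x \<subseteq> A" and y: "set_ctree y \<subseteq> A"
    and z1: "weighted_words (Suc (csize x)) z1" and z2: "weighted_words (Suc (csize y)) z2"
    and a: "\<And>i. a i \<le> C * cwt (wt i) x" and b: "\<And>i. b i \<le> D * cwt (wt i) y"
  shows "\<exists>r. weighted_words (Suc (csize x + csize y)) r \<and> (\<forall>i. 
    inv (cval G x [^] a i \<otimes> z1 i) \<otimes> inv (cval G y [^] b i \<otimes> z2 i) \<otimes> (cval G x [^] a i \<otimes> z1 i)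
      \<otimes> (cval G y [^] b i \<otimes> z2 i) = cval G (Node x y) [^] (a i * b i :: nat) \<otimes> r i)"
proof -
  obtain w1 C1 where w1: "\<And>i. built_on A (Suc (csize x)) (w1 i)" "\<And>i t. count_list (w1 i) t \<le> C1 t * cwt (wt i) t"
    "\<And>i. wval G (w1 i) = z1 i" "\<And>i. built_on (carrier G) 0 (w1 i)" using z1 by (rule weighted_wordsE) blast
  obtain w2 C2 where w2: "\<And>i. built_on A (Suc (csize y)) (w2 i)" "\<And>i t. count_list (w2 i) t \<le> C2 t * cwt (wt i) t"
    "\<And>i. wval G (w2 i) = z2 i" "\<And>i. built_on (carrier G) 0 (w2 i)" using z2 by (rule weighted_wordsE) blast
  define w where "w = (\<lambda>i. replicate (a i) x @ w1 i)"
  define v where "v = (\<lambda>i. replicate (b i) y @ w2 i)"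
  have bw: "built_on A (csize x) (w i)" for i
    unfolding w_def using w1(1)[of i] x by (auto intro: built_on_mono built_on_replicate)
  have bv: "built_on A (csize y) (v i)" for i
    unfolding v_def using w2(1)[of i] y by (auto intro: built_on_mono built_on_replicate)
  note bwc = built_on_carrier[OF bw] and bvc = built_on_carrier[OF bv]
  have vw: "wval G (w i) = cval G x [^] a i \<otimes> z1 i" for i
    unfolding w_def using w1 x A_carrier
    by (subst wval_append) (auto simp: wval_replicate intro: built_on_carrier[OF built_on_replicate])
  have vv: "wval G (v i) = cval G y [^] b i \<otimes> z2 i" for i
    unfolding v_def using w2 y A_carrier
    by (subst wval_append) (auto simp: wval_replicate intro: built_on_carrier[OF built_on_replicate])
  have cw: "count_list (w i) t \<le> (C + C1 t) * cwt (wt i) t" for i t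
    unfolding w_def using w1(2)[of i t] a[of i] by (auto simp: add_mult_distrib intro: add_mono)
  have cv: "count_list (v i) t \<le> (D + C2 t) * cwt (wt i) t" for i t
    unfolding v_def using w2(2)[of i t] b[of i] by (auto simp: add_mult_distrib intro: add_mono)
  let ?c = "Node x y"
  define u where "u = (\<lambda>i. commw (w i) (v i))"
  have bu: "built_on A (csize ?c) (u i)" for i
    unfolding u_def using built_on_commw[OF bw bv] by simp
  have notx: "x \<notin> set (w1 i)" "y \<notin> set (w2 i)" for i
    using w1(1)[of i] w2(1)[of i] by (auto simp: built_on_def)
  have cu: "count_list (u i) ?c = a i * b i" for i
    unfolding u_def count_commw_small[OF bw bv]
    using notx[of i] by (simp add: w_def v_def count_notin)
  \<comment> \<open>The nesting follows \<open>count_commw\<close>: first \<open>v i\<close> crosses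
    \<open>w i\<close>, then \<open>w i\<close> crosses the result.\<close>
  define C0 where "C0 = count_bound (\<lambda>t. count_bound (\<lambda>t. C + C1 t) (\<lambda>t. D + C2 t) t) (\<lambda>t. C + C1 t)"
  have ucount: "count_list (u i) t \<le> C0 t * cwt (wt i) t" for i t
  proof -
    have p: "count_list (push (w i) (v i)) t \<le> count_bound (\<lambda>t. C + C1 t) (\<lambda>t. D + C2 t) t * cwt (wt i) t" for t
      using order_trans[OF count_push count_bound_mono[OF cw[of i] cv[of i]]] by (simp add: count_bound_cwt)
    show ?thesis unfolding u_def C0_def
      using order_trans[OF count_commw count_bound_mono[OF p cw[of i]]] by (simp add: count_bound_cwt)
  qed
  define r where "r = (\<lambda>i. collect ?c [] (u i))"
  \<comment> \<open>Apart from x and y themselves, all letters of \<open>w i\<close> and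
    \<open>v i\<close> have more leaves than x and y respectively, so every commutator other than
    [x, y] is longer than [x, y].\<close>
  have small: "t = ?c \<or> csize ?c < csize t" if t: "t \<in> set (u i)" for t i
  proof -
    from t obtain y' x' where yx: "y' \<in> set (w i)" "x' \<in> set (v i)" "t = Node y' x' \<or> csize y' + csize x' < csize t"
      unfolding u_def using set_commw_cases by blast
    have "y' = x \<or> csize x < csize y'" using yx(1) w1(1)[of i] by (auto simp: w_def built_on_def)
    moreover have "x' = y \<or> csize y < csize x'" using yx(2) w2(1)[of i] by (auto simp: v_def built_on_def)
    ultimately show ?thesis using yx(3) by auto
  qed
  have br: "built_on A (Suc (csize ?c)) (r i)" for i
  proof -
    have "built_on A 0 (r i)" unfolding r_def using bu[of i] x y
      by (intro built_on_collect) (auto intro: built_on_mono)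
    moreover have "csize ?c < csize t" if "t \<in> set (r i)" for t
    proof -
      have "t \<in> set (u i) - {?c} \<or> csize ?c < csize t"
        using set_collect_cases[of t ?c "[]" "u i"] that unfolding r_def by simp
      then show ?thesis using small[of t i] by auto
    qed
    ultimately show ?thesis unfolding built_on_def by (auto simp: Suc_le_eq simp del: csize.simps)
  qed
  have "weighted_words (Suc (csize ?c)) (\<lambda>i. wval G (r i))"
  proof (rule weighted_wordsI[of _ r "\<lambda>t. count_bound C0 C0 t"])
    fix i t
    have "count_list (r i) t \<le> count_bound (\<lambda>t. C0 t * cwt (wt i) t) (\<lambda>t. C0 t * cwt (wt i) t) t"
      unfolding r_def by (rule order_trans[OF count_collect]) (intro count_bound_mono, auto intro: ucount)
    then show "count_list (r i) t \<le> count_bound C0 C0 t * cwt (wt i) t" by (simp add: count_bound_cwt)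
  qed (use br in auto)
  moreover have "inv (cval G x [^] a i \<otimes> z1 i) \<otimes> inv (cval G y [^] b i \<otimes> z2 i) \<otimes> (cval G x [^] a i \<otimes> z1 i)
      \<otimes> (cval G y [^] b i \<otimes> z2 i) = cval G (Node x y) [^] (a i * b i) \<otimes> wval G (r i)" for i
  proof -
    have "cval G ?c [^] (a i * b i) \<otimes> wval G (r i) = wval G (u i)"
      using wval_collect[of "[]" "u i" ?c] cu[of i] built_on_carrier[OF bu] x y A_carrier
      by (simp add: r_def wval_closed subset_trans del: cval.simps)
    also have "\<dots> = inv (wval G (w i)) \<otimes> inv (wval G (v i)) \<otimes> wval G (w i) \<otimes> wval G (v i)"
      unfolding u_def by (rule wval_commw[OF bwc bvc])
    finally show ?thesis by (simp add: vw vv)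
  qed
  ultimately show ?thesis by (intro exI[of _ "\<lambda>i. wval G (r i)"]) simp
qed

lemma power_products_mod_power:
  assumes "set_ctree t \<subseteq> A" "\<And>i. n i \<le> C * cwt (wt i) t"
  shows "power_products_mod (Suc (csize t)) (\<lambda>i. cval G t [^] (n i :: nat))"
  using assms
proof (induction t arbitrary: n C)
  case (Leaf s)
  have "power_products (\<lambda>i. s [^] n i)" using Leaf by (intro power_products_power[of s n C]) auto
  moreover have "s \<in> carrier G" using Leaf A_carrier by auto
  ultimately show ?case unfolding power_products_mod_def using weighted_words_one[of "Suc (csize (Leaf s))"]
    by (intro exI[of _ "\<lambda>i. s [^] n i"]) simp
next
  case (Node x y)
  have x: "set_ctree x \<subseteq> A" and y: "set_ctree y \<subseteq> A" using Node.prems by auto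
  have c: "cval G x \<in> carrier G" "cval G y \<in> carrier G" "cval G (Node x y) \<in> carrier G"
    using x y A_carrier cval_closed[of x] cval_closed[of y] by auto
  have *: "power_products_mod (Suc (csize (Node x y))) (\<lambda>i. cval G (Node x y) [^] (a i * b i))"
    if a: "\<And>i. a i \<le> C * cwt (wt i) x" and b: "\<And>i. b i \<le> D * cwt (wt i) y" for a b :: "'i \<Rightarrow> nat" and C D
  proof -
    obtain U where U: "power_products U" "weighted_words (Suc (csize x)) (\<lambda>i. inv (U i) \<otimes> cval G x [^] a i)"
      using Node.IH(1)[OF x a] unfolding power_products_mod_def by blast
    obtain V where V: "power_products V" "weighted_words (Suc (csize y)) (\<lambda>i. inv (V i) \<otimes> cval G y [^] b i)"
      using Node.IH(2)[OF y b] unfolding power_products_mod_def by blast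
    note cl = power_products_closed[OF U(1)] power_products_closed[OF V(1)] c
    obtain r where r: "weighted_words (Suc (csize (Node x y))) r"
      "\<And>i. inv (cval G x [^] a i \<otimes> inv (inv (U i) \<otimes> cval G x [^] a i)) \<otimes>
         inv (cval G y [^] b i \<otimes> inv (inv (V i) \<otimes> cval G y [^] b i)) \<otimes>
         (cval G x [^] a i \<otimes> inv (inv (U i) \<otimes> cval G x [^] a i)) \<otimes>
         (cval G y [^] b i \<otimes> inv (inv (V i) \<otimes> cval G y [^] b i))
        = cval G (Node x y) [^] (a i * b i) \<otimes> r i"
      using weighted_words_comm_power[OF x y weighted_words_inv[OF U(2)] weighted_words_inv[OF V(2)] a b] by auto
    \<comment> \<open>The corrections are chosen so that x^a z1 is the bounded product U and y^b z2
      is V. Hence [U, V] is at once a bounded product of powers and equal to [x, y]^(a b) r.\<close>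
    have 1: "cval G x [^] a i \<otimes> inv (inv (U i) \<otimes> cval G x [^] a i) = U i" for i
      using cl by (simp add: inv_mult_group)
    have 2: "cval G y [^] b i \<otimes> inv (inv (V i) \<otimes> cval G y [^] b i) = V i" for i
      using cl by (simp add: inv_mult_group)
    define Z where "Z = (\<lambda>i. inv (U i) \<otimes> inv (V i) \<otimes> U i \<otimes> V i)"
    have Z: "power_products Z" unfolding Z_def using U V by (intro power_products_mult power_products_inv)
    have "inv (Z i) \<otimes> cval G (Node x y) [^] (a i * b i) = inv (r i)" for i
    proof -
      have "Z i = cval G (Node x y) [^] (a i * b i) \<otimes> r i" using r(2)[of i] by (simp only: 1 2 Z_def)
      then show ?thesis using weighted_words_closed[OF r(1), of i] cl(5)
        by (simp add: inv_mult_group m_assoc del: cval.simps)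
    qed
    then show ?thesis unfolding power_products_mod_def using Z weighted_words_inv[OF r(1)] by (intro exI[of _ Z]) simp
  qed
  \<comment> \<open>A general n need not be a product of two admissible exponents. Division by the
    weight e of y gives n = a e + 1 b with b < e, and \<open>*\<close> covers both summands; a is at
    most C times the weight of x because n is at most C times the product of the weights.\<close>
  define a where "a = (\<lambda>i. n i div cwt (wt i) y)"
  define b where "b = (\<lambda>i. n i mod cwt (wt i) y)"
  have "a i \<le> C * cwt (wt i) x" for i
    unfolding a_def using Node.prems(2)[of i] cwt_pos[OF y, of i] div_le_mono
    by (metis cwt.simps(2) mult.assoc nonzero_mult_div_cancel_right not_one_le_zero)
  then have 1: "power_products_mod (Suc (csize (Node x y))) (\<lambda>i. cval G (Node x y) [^] (a i * cwt (wt i) y))"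
    by (intro *[of a C "\<lambda>i. cwt (wt i) y" 1]) auto
  have "b i \<le> 1 * cwt (wt i) y" for i
    unfolding b_def using cwt_pos[OF y, of i] by (simp add: less_imp_le)
  then have 2: "power_products_mod (Suc (csize (Node x y))) (\<lambda>i. cval G (Node x y) [^] (1 * b i))"
    using cwt_pos[OF x] by (intro *[of "\<lambda>_. 1" 1 b 1]) auto
  have n: "cval G (Node x y) [^] (a i * cwt (wt i) y) \<otimes> cval G (Node x y) [^] (1 * b i)
      = cval G (Node x y) [^] n i" for i
  proof -
    have "a i * cwt (wt i) y + 1 * b i = n i" unfolding a_def b_def mult_1 by (rule div_mult_mod_eq)
    then show ?thesis using nat_pow_mult[OF c(3)] by presburger
  qed
  show ?case using power_products_mod_mult[OF 1 2] c(3) unfolding n by blast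
qed

lemma finite_ctree_size: "finite {t. set_ctree t \<subseteq> A \<and> csize t \<le> q}"
proof (induction q)
  case 0
  have "{t. set_ctree t \<subseteq> A \<and> csize t \<le> 0} = {}" by (auto simp: leD)
  then show ?case by (metis finite.emptyI)
next
  case (Suc q)
  let ?T = "{t. set_ctree t \<subseteq> A \<and> csize t \<le> q}"
  have "t \<in> Leaf ` A \<union> (\<lambda>(x, y). Node x y) ` (?T \<times> ?T)" if "set_ctree t \<subseteq> A" "csize t \<le> Suc q" for t
  proof (cases t)
    case (Node x y)
    have "csize x \<le> q" "csize y \<le> q" using that Node csize_pos[of x] csize_pos[of y] by (auto simp del: csize_pos)
    then show ?thesis using that Node by auto
  qed (use that in auto)
  then have "{t. set_ctree t \<subseteq> A \<and> csize t \<le> Suc q} \<subseteq> Leaf ` A \<union> (\<lambda>(x, y). Node x y) ` (?T \<times> ?T)" by blast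
  then show ?case using Suc A_finite by (meson finite_SigmaI finite_UnI finite_imageI finite_subset)
qed

text \<open>\<open>ts\<close> lists the trees with exactly q leaves that may still occur. Collecting
  one of them turns it into a power and creates only larger trees, so the list gets shorter; being
  finite, it lets the constants change only finitely often.\<close>

lemma power_products_mod_collect:
  assumes "set ts \<subseteq> {t. set_ctree t \<subseteq> A \<and> csize t = q}"
    and "\<And>i. built_on A q (w i)" "\<And>i t. count_list (w i) t \<le> C t * cwt (wt i) t"
    and "\<And>i t. t \<in> set (w i) \<Longrightarrow> csize t = q \<Longrightarrow> t \<in> set ts"
  shows "power_products_mod (Suc q) (\<lambda>i. wval G (w i))"
  using assms
proof (induction ts arbitrary: w C)
  case Nil
  have "built_on A (Suc q) (w i)" for i
    using Nil.prems(4)[of _ i] Nil.prems(2)[of i] unfolding built_on_def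
    by (metis empty_iff le_antisym list.set(1) not_less_eq_eq)
  then show ?case using Nil.prems(3) by (intro power_products_mod_weighted_words weighted_wordsI[of _ w C]) auto
next
  case (Cons t ts)
  have t: "set_ctree t \<subseteq> A" "csize t = q" using Cons.prems by auto
  define v where "v = (\<lambda>i. collect t [] (w i))"
  have bv: "built_on A q (v i)" for i unfolding v_def using Cons.prems(2) t by (auto intro!: built_on_collect)
  have 1: "power_products_mod (Suc q) (\<lambda>i. wval G (v i))"
  proof (rule Cons.IH[of v "\<lambda>t. count_bound C C t"])
    fix i s
    have "count_list (v i) s \<le> count_bound (\<lambda>t. C t * cwt (wt i) t) (\<lambda>t. C t * cwt (wt i) t) s"
      unfolding v_def by (rule order_trans[OF count_collect]) (intro count_bound_mono, auto intro: Cons.prems)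
    then show "count_list (v i) s \<le> count_bound C C s * cwt (wt i) s" by (simp add: count_bound_cwt)
  next
    fix i s assume "s \<in> set (v i)" "csize s = q"
    then show "s \<in> set ts"
      using set_collect_cases[of s t "[]" "w i"] t Cons.prems(4)[of s i] by (auto simp: v_def)
  qed (use Cons.prems bv in auto)
  have 2: "power_products_mod (Suc q) (\<lambda>i. cval G t [^] count_list (w i) t)"
    using power_products_mod_power[OF t(1), of "\<lambda>i. count_list (w i) t" "C t"] Cons.prems(3) t by auto
  have c: "cval G t \<in> carrier G" "\<And>i. wval G (v i) \<in> carrier G" "\<And>i. wval G (w i) \<in> carrier G"
    using t A_carrier built_on_carrier[OF bv] built_on_carrier[OF Cons.prems(2)]
    by (auto intro!: cval_closed wval_closed)
  have "cval G t [^] count_list (w i) t \<otimes> wval G (v i) = wval G (w i)" for i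
    using wval_collect[of "[]" "w i" t] built_on_carrier[OF Cons.prems(2)] t A_carrier c by (simp add: v_def subset_trans)
  then show ?case using power_products_mod_mult[OF 2 1] c by simp
qed

lemma weighted_words_mod_Suc:
  assumes "weighted_words q g" shows "power_products_mod (Suc q) g"
proof -
  obtain w C where w: "\<And>i. built_on A q (w i)" "\<And>i t. count_list (w i) t \<le> C t * cwt (wt i) t"
    "\<And>i. wval G (w i) = g i" using assms(1) by (rule weighted_wordsE) blast
  have "finite {t. set_ctree t \<subseteq> A \<and> csize t = q}"
    by (rule finite_subset[OF _ finite_ctree_size[of q]]) auto
  from finite_list[OF this] obtain ts where ts: "set ts = {t. set_ctree t \<subseteq> A \<and> csize t = q}" ..
  have "power_products_mod (Suc q) (\<lambda>i. wval G (w i))"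
    by (rule power_products_mod_collect[of ts q w C]) (use w ts in \<open>auto simp: built_on_def\<close>)
  then show ?thesis using w(3) by simp
qed

lemma weighted_words_mod:
  assumes "weighted_words 0 g" shows "power_products_mod q g"
proof (induction q)
  case 0
  then show ?case using assms by (rule power_products_mod_weighted_words)
next
  case (Suc q)
  then obtain U where U: "power_products U" "weighted_words q (\<lambda>i. inv (U i) \<otimes> g i)" unfolding power_products_mod_def by blast
  then obtain V where V: "power_products V" "weighted_words (Suc q) (\<lambda>i. inv (V i) \<otimes> (inv (U i) \<otimes> g i))"
    using weighted_words_mod_Suc unfolding power_products_mod_def by blast
  have "inv (V i) \<otimes> (inv (U i) \<otimes> g i) = inv (U i \<otimes> V i) \<otimes> g i" for i
    using power_products_closed[OF U(1), of i] power_products_closed[OF V(1), of i] weighted_words_closed[OF assms, of i]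
    by (simp add: inv_mult_group m_assoc)
  then show ?case using power_products_mult[OF U(1) V(1)] V(2) unfolding power_products_mod_def by auto
qed

end

section \<open>Long commutators vanish in a nilpotent group\<close>

context group
begin

lemma lower_central_props:
  assumes "subgroup N G"
  shows "subgroup (lower_central G N n) G \<and> lower_central G N n \<subseteq> N"
proof (induction n)
  case (Suc n)
  have N: "N \<subseteq> carrier G" using assms by (rule subgroup.subset)
  have "{commutator G x y | x y. x \<in> N \<and> y \<in> lower_central G N n} \<subseteq> N"
    unfolding commutator_def using Suc assms
    by (auto intro!: subgroup.m_closed subgroup.m_inv_closed)
  then show ?case using N assms
    by (simp, meson generate_is_subgroup generate_subgroup_incl subset_trans)
qed (use assms in auto)

text \<open>Using the height instead of the number of leaves avoids the inclusion
  \<open>[\<Gamma>\<^sub>i, \<Gamma>\<^sub>j] \<subseteq> \<Gamma>\<^sub>i\<^sub>+\<^sub>j\<close> for the lower central series.\<close>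

lemma cval_lower_central:
  assumes "subgroup N G" "set_ctree t \<subseteq> N"
  shows "cval G t \<in> lower_central G N (cheight t)"
  using assms(2)
proof (induction t)
  case (Node x y)
  note lc = lower_central_props[OF assms(1)]
  have N: "N \<subseteq> carrier G" using assms by (simp add: subgroup.subset)
  have xy: "cval G x \<in> lower_central G N (cheight x)" "cval G y \<in> lower_central G N (cheight y)"
    using Node by auto
  have xyN: "cval G x \<in> N" "cval G y \<in> N" using xy lc by blast+
  have xyc: "cval G x \<in> carrier G" "cval G y \<in> carrier G" using xyN N by auto
  have comm: "inv a \<otimes> inv b \<otimes> a \<otimes> b \<in> lower_central G N (Suc n)"
    if "a \<in> N" "b \<in> lower_central G N n" for a b n
  proof -
    \<comment> \<open>The two commutator conventions differ: a^-1 b^-1 a b is x y x^-1 y^-1 at x =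
      a^-1, y = b^-1.\<close>
    have "inv a \<in> N" "inv b \<in> lower_central G N n"
      using that assms(1) lc[of n] by (auto intro: subgroup.m_inv_closed)
    moreover have "a \<in> carrier G" "b \<in> carrier G" using that lc N by blast+
    then have "inv a \<otimes> inv b \<otimes> a \<otimes> b = commutator G (inv a) (inv b)"
      by (simp add: commutator_def)
    ultimately show ?thesis by (auto intro!: generate.incl)
  qed
  show ?case
  proof (cases "cheight x \<le> cheight y")
    case True
    then have "cheight (Node x y) = Suc (cheight y)" by simp
    then show ?thesis using comm[OF xyN(1) xy(2)] by (simp only: cval.simps)
  next
    case False
    then have h: "cheight (Node x y) = Suc (cheight x)" by simp
    \<comment> \<open>\<open>lower_central\<close> has the deeper entry in second place, so a deeper
      left subtree is handled through [x, y] = [y, x]^-1.\<close>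
    have "inv (inv (cval G y) \<otimes> inv (cval G x) \<otimes> cval G y \<otimes> cval G x) \<in> lower_central G N (Suc (cheight x))"
      using comm[OF xyN(2) xy(1)] lc[of "Suc (cheight x)"] by (blast intro: subgroup.m_inv_closed)
    then show ?thesis unfolding h using xyc by (simp add: inv_mult_group m_assoc del: lower_central.simps)
  qed
qed auto

lemma lower_central_trivial:
  assumes "subgroup N G" "lower_central G N n = {\<one>}" "n \<le> k"
  shows "lower_central G N k = {\<one>}"
  using assms(3)
proof (induction k rule: dec_induct)
  case (step k)
  have N: "N \<subseteq> carrier G" using assms by (simp add: subgroup.subset)
  have "\<one> \<in> N" using assms(1) by (rule subgroup.one_closed)
  then have "{commutator G x y | x y. x \<in> N \<and> y \<in> lower_central G N k} = {\<one>}"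
    using step N by (auto simp: commutator_def intro!: exI[of _ \<one>])
  then show ?case by (simp add: generate_one)
qed (use assms in simp)

lemma cval_trivial:
  assumes "subgroup N G" "lower_central G N n = {\<one>}" "set_ctree t \<subseteq> N" "2 ^ n < csize t"
  shows "cval G t = \<one>"
proof -
  have "(2::nat) ^ n < 2 ^ cheight t" using assms(4) csize_le_pow_height[of t] by linarith
  then have "n \<le> cheight t" by simp
  then show ?thesis using cval_lower_central[OF assms(1,3)] lower_central_trivial[OF assms(1,2)] by blast
qed

end

text \<open>For q = 2^n + 1 each letter of the error word has value one, so the congruence becomes
  an equality.\<close>

lemma (in weighted_family) weighted_words_imp_power_products:
  assumes "nilpotent_subgroup G N" "A \<subseteq> N" "weighted_words 0 g"
  shows "power_products g"
proof -
  obtain n where N: "subgroup N G" "lower_central G N n = {\<one>}"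
    using assms(1) unfolding nilpotent_subgroup_def by blast
  obtain U where U: "power_products U" "weighted_words (Suc (2 ^ n)) (\<lambda>i. inv (U i) \<otimes> g i)"
    using weighted_words_mod[OF assms(3)] unfolding power_products_mod_def by blast
  have triv: "wval G w = \<one>" if "built_on A (Suc (2 ^ n)) w" for w
    using that by (induction w) (use cval_trivial[OF N] assms(2) in auto)
  have "inv (U i) \<otimes> g i = \<one>" for i
    using U(2) triv by (elim weighted_wordsE) metis
  then have "g i = U i" for i
    using power_products_closed[OF U(1), of i] weighted_words_closed[OF assms(3), of i] by (metis inv_equality inv_inv inv_closed)
  then show ?thesis using U(1) by (metis ext)
qed

section \<open>Scale functions\<close>

text \<open>The common ground of \<open>Phi0\<close> and \<open>PhiI\<close>. Quadratic growth turns
  constant factors in a degree into constant factors in the cost, linearity on [0, 1] controls the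
  inverse at 0, and unboundedness makes the supremum in \<open>inv_fun\<close> finite.\<close>

definition quadratic_scale :: "(real \<Rightarrow> real) \<Rightarrow> bool" where
  "quadratic_scale f \<longleftrightarrow> f 1 > 0 \<and> (\<forall>t. 0 \<le> t \<longrightarrow> t \<le> 1 \<longrightarrow> f t = t * f 1) \<and> mono_on {0..} f
     \<and> (\<forall>c t. 1 \<le> c \<longrightarrow> 0 \<le> t \<longrightarrow> f (c * t) \<le> c\<^sup>2 * f t) \<and> (\<forall>y. \<exists>t\<ge>0. y < f t)"

lemma quadratic_scaleD:
  assumes "quadratic_scale f"
  shows "f 1 > 0" "\<And>t. 0 \<le> t \<Longrightarrow> t \<le> 1 \<Longrightarrow> f t = t * f 1"
    "\<And>s t. 0 \<le> s \<Longrightarrow> s \<le> t \<Longrightarrow> f s \<le> f t"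
    "\<And>c t. 1 \<le> c \<Longrightarrow> 0 \<le> t \<Longrightarrow> f (c * t) \<le> c\<^sup>2 * f t"
    "\<And>y. \<exists>t\<ge>0. y < f t" "f 0 = 0" "\<And>t. 0 \<le> t \<Longrightarrow> 0 \<le> f t" "\<And>t. 0 < t \<Longrightarrow> 0 < f t"
proof -
  note d = assms[unfolded quadratic_scale_def]
  show 1: "f 1 > 0" using d by blast
  show 2: "f t = t * f 1" if "0 \<le> t" "t \<le> 1" for t using d that by blast
  show 3: "f s \<le> f t" if "0 \<le> s" "s \<le> t" for s t
  proof (rule mono_onD[of "{0..}" f])
    show "mono_on {0..} f" using d by blast
  qed (use that in auto)
  show "f (c * t) \<le> c\<^sup>2 * f t" if "1 \<le> c" "0 \<le> t" for c t using d that by blast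
  show "\<exists>t\<ge>0. y < f t" for y using d by blast
  show 0: "f 0 = 0" using 2[of 0] by simp
  show "0 \<le> f t" if "0 \<le> t" for t using 3[of 0 t] that 0 by simp
  show "0 < f t" if "0 < t" for t
  proof (cases "t \<le> 1")
    case True
    then show ?thesis using 2[of t] 1 that by simp
  next
    case False
    then show ?thesis using 3[of 1 t] 1 by simp
  qed
qed

lemma inv_fun_le:
  assumes "quadratic_scale f" "0 \<le> t" "0 \<le> y" "t < f y"
  shows "inv_fun f t \<le> y"
  unfolding inv_fun_def
proof (rule cSup_least)
  show "{s. 0 \<le> s \<and> f s \<le> t} \<noteq> {}"
    using quadratic_scaleD(6)[OF assms(1)] assms(2) by (auto intro!: exI[of _ 0])
  fix s assume "s \<in> {s. 0 \<le> s \<and> f s \<le> t}"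
  then show "s \<le> y" using quadratic_scaleD(3)[OF assms(1), of y s] assms by force
qed

text \<open>\<open>inv_fun\<close> is a supremum of preimages, so a bound y on it says only that f
  exceeds t strictly beyond y; this is the reason for the second point y'.\<close>

lemma inv_fun_le_imp_less:
  assumes "quadratic_scale f" "inv_fun f t \<le> y" "0 \<le> y" "y < y'"
  shows "t < f y'"
proof (rule ccontr)
  assume "\<not> t < f y'"
  moreover have "bdd_above {s. 0 \<le> s \<and> f s \<le> t}"
  proof -
    obtain b where b: "b \<ge> 0" "t < f b" using quadratic_scaleD(5)[OF assms(1)] by blast
    have "s \<le> b" if "0 \<le> s" "f s \<le> t" for s
      using quadratic_scaleD(3)[OF assms(1), of b s] b that by force
    then show ?thesis by (auto intro: bdd_aboveI[of _ b])
  qed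
  ultimately have "y' \<le> inv_fun f t"
    unfolding inv_fun_def using assms by (intro cSup_upper) auto
  then show False using assms by simp
qed

lemma inv_fun_zero_le:
  assumes "quadratic_scale f"
  shows "inv_fun f 0 \<le> 0"
proof (rule field_le_epsilon)
  fix e :: real assume "0 < e"
  then show "inv_fun f 0 \<le> 0 + e"
    using inv_fun_le[OF assms, of 0 e] quadratic_scaleD(8)[OF assms, of e] by simp
qed

lemma weight_fun_le_iff:
  assumes "s \<in> A i" "i \<le> k"
  shows "weight_fun \<phi> k A s t \<le> y \<longleftrightarrow> (\<forall>i\<le>k. s \<in> A i \<longrightarrow> inv_fun (Phi \<phi> i) t \<le> y)"
  unfolding weight_fun_def using assms by (subst Max_le_iff) auto

text \<open>A maximum of inverses is at most y exactly if each of them is, which means that every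
  \<open>Phi \<phi> i\<close> exceeds t just beyond y. The supremum of such t is therefore the least
  \<open>Phi \<phi> i y\<close>, up to the cost of going beyond y.\<close>

lemma inv_weight_bounds:
  assumes sc: "\<And>i. i \<le> k \<Longrightarrow> quadratic_scale (Phi \<phi> i)"
    and s: "s \<in> A j" "j \<le> k" and y: "0 \<le> y"
  shows inv_weight_upper: "\<And>i. i \<le> k \<Longrightarrow> s \<in> A i \<Longrightarrow> inv_fun (weight_fun \<phi> k A s) y \<le> 4 * Phi \<phi> i y"
    and inv_weight_lower: "\<exists>i\<le>k. s \<in> A i \<and> Phi \<phi> i y \<le> inv_fun (weight_fun \<phi> k A s) y"
proof -
  let ?F = "weight_fun \<phi> k A s"
  let ?S = "{t. 0 \<le> t \<and> ?F t \<le> y}"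
  have zero: "0 \<in> ?S"
    using inv_fun_zero_le[OF sc] y weight_fun_le_iff[of s A j k \<phi> 0 y] s by (auto intro: order_trans)
  have up: "t \<le> 4 * Phi \<phi> i y" if i: "i \<le> k" "s \<in> A i" and t: "t \<in> ?S" for i t
  proof -
    have "?F t \<le> y" using t by simp
    then have "inv_fun (Phi \<phi> i) t \<le> y" using weight_fun_le_iff[of s A j k \<phi> t y] s i by blast
    then have less: "t < Phi \<phi> i y'" if "y < y'" for y'
      using inv_fun_le_imp_less[OF sc[OF i(1)]] y that by blast
    show ?thesis
    proof (cases "y = 0")
      case False
      \<comment> \<open>Twice y lies beyond y, and 4 = 2^2.\<close>
      then have "t < Phi \<phi> i (2 * y)" using y by (intro less) simp
      also have "\<dots> \<le> 4 * Phi \<phi> i y" using quadratic_scaleD(4)[OF sc[OF i(1)], of 2 y] y by simp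
      finally show ?thesis by simp
    next
      case True
      note q = quadratic_scaleD[OF sc[OF i(1)]]
      have "t \<le> 0"
      proof (rule ccontr)
        assume "\<not> t \<le> 0"
        \<comment> \<open>On [0, 1] the scale is linear with slope \<open>Phi \<phi> i 1\<close>, so
          its value at this y' is at most t, against t < \<open>Phi \<phi> i y'\<close>.\<close>
        define y' where "y' = min 1 (t / Phi \<phi> i 1)"
        have y': "0 < y'" "y' \<le> 1" using \<open>\<not> t \<le> 0\<close> q(1) by (auto simp: y'_def)
        have "Phi \<phi> i y' = y' * Phi \<phi> i 1" using q(2)[of y'] y' by simp
        also have "\<dots> \<le> t / Phi \<phi> i 1 * Phi \<phi> i 1" using q(1) by (intro mult_right_mono) (auto simp: y'_def)
        also have "\<dots> = t" using q(1) by simp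
        finally show False using less[of y'] y' True by simp
      qed
      then show ?thesis using q(6) True by simp
    qed
  qed
  show "inv_fun ?F y \<le> 4 * Phi \<phi> i y" if i: "i \<le> k" "s \<in> A i" for i
    unfolding inv_fun_def using up[OF i] zero by (intro cSup_least) auto
  have bdd: "bdd_above ?S" using up[OF s(2,1)] by (intro bdd_aboveI) blast
  let ?I = "{i. i \<le> k \<and> s \<in> A i}"
  \<comment> \<open>For the index with the least value, every t strictly below that value belongs to
    the set whose supremum is taken.\<close>
  have "Min ((\<lambda>i. Phi \<phi> i y) ` ?I) \<in> (\<lambda>i. Phi \<phi> i y) ` ?I"
    using s by (intro Min_in) auto
  then obtain i where i: "i \<le> k" "s \<in> A i" "Phi \<phi> i y = Min ((\<lambda>i. Phi \<phi> i y) ` ?I)" by auto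
  have min: "Phi \<phi> i y \<le> Phi \<phi> i' y" if "i' \<le> k" "s \<in> A i'" for i'
    unfolding i(3) using that by (intro Min_le) auto
  have nn: "0 \<le> inv_fun ?F y" unfolding inv_fun_def by (rule cSup_upper[OF zero bdd])
  have "Phi \<phi> i y \<le> inv_fun ?F y"
  proof (cases "0 < Phi \<phi> i y")
    case True
    then show ?thesis
    proof (rule dense_le_bounded)
      fix t assume t: "0 < t" "t < Phi \<phi> i y"
      have "inv_fun (Phi \<phi> i') t \<le> y" if "i' \<le> k" "s \<in> A i'" for i'
        using inv_fun_le[OF sc[OF that(1)], of t y] t y min[OF that] by simp
      then have "t \<in> ?S" using t weight_fun_le_iff[of s A j k \<phi> t y] s by auto
      then show "t \<le> inv_fun ?F y" unfolding inv_fun_def by (rule cSup_upper[OF _ bdd])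
    qed
  qed (use nn in simp)
  then show "\<exists>i\<le>k. s \<in> A i \<and> Phi \<phi> i y \<le> inv_fun ?F y" using i by blast
qed

lemma quadratic_scale_Phi0: "quadratic_scale Phi0"
  unfolding quadratic_scale_def
proof (intro conjI allI impI)
  show "Phi0 1 > 0" by (simp add: Phi0_def)
  show "mono_on {0..} Phi0"
  proof (rule mono_onI)
    fix r s :: real assume "r \<in> {0..}" "r \<le> s"
    then show "Phi0 r \<le> Phi0 s" using power_mono[of r s 2] by (simp add: Phi0_def max.coboundedI1 max.coboundedI2)
  qed
  fix t :: real assume t: "0 \<le> t"
  {
    assume "t \<le> 1"
    then have "t\<^sup>2 \<le> t" using t by (simp add: power2_eq_square mult_left_le)
    then show "Phi0 t = t * Phi0 1" by (simp add: Phi0_def)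
  }
  fix c :: real assume c: "1 \<le> c"
  have "c \<le> c\<^sup>2" using c by (simp add: power2_eq_square)
  then have "c * t \<le> c\<^sup>2 * max t (t\<^sup>2)" using t c by (intro mult_mono) auto
  moreover have "(c * t)\<^sup>2 \<le> c\<^sup>2 * max t (t\<^sup>2)" by (auto simp: power_mult_distrib intro: mult_left_mono)
  ultimately show "Phi0 (c * t) \<le> c\<^sup>2 * Phi0 t" by (simp add: Phi0_def)
next
  fix y :: real
  show "\<exists>t\<ge>0. y < Phi0 t"
    by (intro exI[of _ "max 0 y + 1"]) (auto simp: Phi0_def)
qed

text \<open>Far out, each doubling of the argument multiplies \<open>\<phi>\<close> by more than a
  fixed c between 1 and 2^\<gamma>, so \<open>\<phi>\<close> exceeds every bound along the points
  2^n a.\<close>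

lemma regularly_varying_unbounded:
  assumes pos: "\<And>t. t \<ge> 0 \<Longrightarrow> \<phi> t > 0" and "\<gamma> > 0" "regularly_varying \<phi> \<gamma>"
  shows "\<exists>a\<ge>1. y < \<phi> a"
proof -
  define c where "c = (1 + 2 powr \<gamma>) / 2"
  have g: "2 powr \<gamma> > (1::real)" using \<open>\<gamma> > 0\<close> by simp
  then have c: "1 < c" "c < 2 powr \<gamma>" by (auto simp: c_def)
  have "((\<lambda>t. \<phi> (2 * t) / \<phi> t) \<longlongrightarrow> 2 powr \<gamma>) at_top"
    using assms(3) unfolding regularly_varying_def by simp
  then have "\<forall>\<^sub>F t in at_top. c < \<phi> (2 * t) / \<phi> t" using c(2) by (rule order_tendstoD)
  then obtain b where b: "\<And>t. t \<ge> b \<Longrightarrow> c < \<phi> (2 * t) / \<phi> t" unfolding eventually_at_top_linorder by blast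
  define a where "a = max 1 b"
  have a: "a \<ge> 1" "a \<ge> b" by (auto simp: a_def)
  have pa: "a \<le> 2 ^ n * a" for n :: nat using a by simp
  have *: "c ^ n * \<phi> a \<le> \<phi> (2 ^ n * a)" for n
  proof (induction n)
    case (Suc n)
    have "c < \<phi> (2 * (2 ^ n * a)) / \<phi> (2 ^ n * a)" using b pa a order_trans by blast
    then have "c * \<phi> (2 ^ n * a) \<le> \<phi> (2 * (2 ^ n * a))"
      using pos[of "2 ^ n * a"] pa[of n] a by (simp add: field_simps)
    moreover have "c * (c ^ n * \<phi> a) \<le> c * \<phi> (2 ^ n * a)" using Suc c by simp
    ultimately show ?case by (simp add: mult.assoc)
  qed simp
  obtain n where "y / \<phi> a < c ^ n" using real_arch_pow[OF c(1)] by blast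
  then have "y < c ^ n * \<phi> a" using pos[of a] a by (simp add: field_simps)
  then show ?thesis using * pa a by (meson order_less_le_trans order_trans)
qed

text \<open>Write \<open>PhiI\<close> as t^2 / I(t) for t >= 1. Since I increases, the scale grows
  at most quadratically. Since \<open>\<phi>\<close> increases, I(a) >= a^2 / \<phi>(a) and I(b) -
  I(a) <= (b^2 - a^2) / \<phi>(a), hence I(b) / I(a) <= b^2 / a^2, which is monotonicity of the
  scale.\<close>

lemma quadratic_scale_PhiI:
  assumes pos: "\<And>t. t \<ge> 0 \<Longrightarrow> \<phi> t > 0" and mono: "mono_on {0..} \<phi>"
    and unb: "\<And>y. \<exists>a\<ge>1. y < \<phi> a"
  shows "quadratic_scale (PhiI \<phi>)" "\<exists>K>0. \<forall>t\<ge>1. PhiI \<phi> t \<le> K * t\<^sup>2"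
proof -
  define I where "I = (\<lambda>t. integral {0..t} (\<lambda>s. 2 * s / \<phi> s))"
  have mon: "\<phi> s \<le> \<phi> t" if "0 \<le> s" "s \<le> t" for s t
    using mono that by (auto intro: mono_onD)
  have int: "(\<lambda>s. 2 * s / \<phi> s) integrable_on {a..b}" if "0 \<le> a" "a \<le> b" for a b
  proof -
    \<comment> \<open>\<open>\<phi>\<close> is merely monotone. The second mean value theorem gives
      integrability of a monotone function times an integrable one; the minus sign makes -1/\<phi>
      nondecreasing.\<close>
    have "\<exists>c\<in>{a..b}. ((\<lambda>x. (- 1 / \<phi> x) *\<^sub>R (2 * x)) has_integral
        (- 1 / \<phi> a) *\<^sub>R integral {a..c} (\<lambda>x. 2 * x) + (- 1 / \<phi> b) *\<^sub>R integral {c..b} (\<lambda>x. 2 * x)) {a..b}"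
    proof (rule second_mean_value_theorem_full)
      show "(\<lambda>x::real. 2 * x) integrable_on {a..b}" by (intro integrable_continuous_real continuous_intros)
      fix x z assume "a \<le> x" "x \<le> z" "z \<le> b"
      then show "- 1 / \<phi> x \<le> - 1 / \<phi> z" using mon[of x z] pos[of x] that by (simp add: frac_le)
    qed (use that in auto)
    then have "(\<lambda>x. (- 1 / \<phi> x) *\<^sub>R (2 * x)) integrable_on {a..b}" by (auto simp: integrable_on_def)
    then have "(\<lambda>x. - ((- 1 / \<phi> x) *\<^sub>R (2 * x))) integrable_on {a..b}" by (rule integrable_neg)
    then show ?thesis by (simp add: mult.commute)
  qed
  have sq: "((\<lambda>s. 2 * s / q) has_integral (b\<^sup>2 - a\<^sup>2) / q) {a..b}" if "a \<le> b" "q > 0" for a b q :: real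
  proof -
    have "((\<lambda>s. 2 * s / q) has_integral (b\<^sup>2 / q - a\<^sup>2 / q)) {a..b}"
      by (rule fundamental_theorem_of_calculus[OF that(1)])
        (use that(2) in \<open>auto intro!: derivative_eq_intros simp flip: has_real_derivative_iff_has_vector_derivative\<close>)
    then show ?thesis by (simp add: diff_divide_distrib)
  qed
  have Ilow: "t\<^sup>2 / \<phi> t \<le> I t" if "0 \<le> t" for t
  proof -
    have "integral {0..t} (\<lambda>s. 2 * s / \<phi> t) \<le> I t" unfolding I_def
      using that int[of 0 t] sq[of 0 t "\<phi> t", OF _ pos] mon pos
      by (intro integral_le) (auto intro!: divide_left_mono)
    then show ?thesis using sq[of 0 t "\<phi> t", OF _ pos] that by (simp add: integral_unique)
  qed
  have Iup: "I b \<le> I a + (b\<^sup>2 - a\<^sup>2) / \<phi> a" if "0 \<le> a" "a \<le> b" for a b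
  proof -
    have "I b = I a + integral {a..b} (\<lambda>s. 2 * s / \<phi> s)"
      unfolding I_def using Henstock_Kurzweil_Integration.integral_combine[OF that int[of 0 b]] that by simp
    moreover have "integral {a..b} (\<lambda>s. 2 * s / \<phi> s) \<le> integral {a..b} (\<lambda>s. 2 * s / \<phi> a)"
      using that int[of a b] sq[of a b "\<phi> a", OF _ pos] mon pos
      by (intro integral_le) (auto intro!: divide_left_mono)
    ultimately show ?thesis using integral_unique[OF sq[OF that(2) pos[OF that(1)]]] by linarith
  qed
  have Ipos: "I t > 0" if "0 < t" for t
  proof -
    have "0 < t\<^sup>2 / \<phi> t" using that pos[of t] by simp
    then show ?thesis using Ilow[of t] that by simp
  qed
  have Imono: "I a \<le> I b" if "0 \<le> a" "a \<le> b" for a b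
  proof -
    have "0 \<le> integral {a..b} (\<lambda>s. 2 * s / \<phi> s)"
    proof (rule integral_nonneg[OF int[OF that]])
      fix s assume "s \<in> {a..b}"
      then show "0 \<le> 2 * s / \<phi> s" using pos[of s] that(1) by simp
    qed
    moreover have "I b = I a + integral {a..b} (\<lambda>s. 2 * s / \<phi> s)"
      unfolding I_def using Henstock_Kurzweil_Integration.integral_combine[OF that int[of 0 b]] that by simp
    ultimately show ?thesis by linarith
  qed
  have P1: "PhiI \<phi> t = t\<^sup>2 / I t" if "1 \<le> t" for t using that by (simp add: PhiI_def I_def)
  have P0: "PhiI \<phi> t = t / I 1" if "t \<le> 1" for t using that by (cases "t = 1") (auto simp: PhiI_def I_def)
  have m1: "PhiI \<phi> a \<le> PhiI \<phi> b" if ab: "1 \<le> a" "a \<le> b" for a b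
  proof -
    have "(b\<^sup>2 - a\<^sup>2) / \<phi> a = (b\<^sup>2 - a\<^sup>2) / a\<^sup>2 * (a\<^sup>2 / \<phi> a)" using ab by simp
    also have "\<dots> \<le> (b\<^sup>2 - a\<^sup>2) / a\<^sup>2 * I a" using Ilow[of a] ab by (intro mult_left_mono) auto
    finally have "I b \<le> I a + (b\<^sup>2 - a\<^sup>2) / a\<^sup>2 * I a" using Iup[of a b] ab by simp
    also have "\<dots> = b\<^sup>2 / a\<^sup>2 * I a" using ab by (simp add: field_simps)
    finally have "I b * a\<^sup>2 \<le> b\<^sup>2 * I a" using ab by (simp add: field_simps)
    moreover have "0 < I a" "0 < I b" using Ipos[of a] Ipos[of b] ab by auto
    ultimately have "a\<^sup>2 / I a \<le> b\<^sup>2 / I b" by (simp add: field_simps)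
    then show ?thesis using P1[of a] P1[of b] ab by simp
  qed
  show "quadratic_scale (PhiI \<phi>)"
    unfolding quadratic_scale_def
  proof (intro conjI allI impI)
    show "PhiI \<phi> 1 > 0" using P1[of 1] Ipos[of 1] by simp
    show "PhiI \<phi> t = t * PhiI \<phi> 1" if "0 \<le> t" "t \<le> 1" for t using P0[of t] P0[of 1] that by simp
    show "mono_on {0..} (PhiI \<phi>)"
    proof (rule mono_onI)
      fix a b :: real assume ab: "a \<in> {0..}" "b \<in> {0..}" "a \<le> b"
      have le1: "PhiI \<phi> a \<le> PhiI \<phi> b" if "b \<le> 1" "a \<le> b" for a b
        using P0[of a] P0[of b] that Ipos[of 1] by (simp add: divide_right_mono)
      consider "b \<le> 1" | "a \<le> 1" "1 \<le> b" | "1 \<le> a" using ab by linarith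
      then show "PhiI \<phi> a \<le> PhiI \<phi> b"
        by cases (use le1[of b a] le1[of 1 a] m1[of 1 b] m1[of a b] ab in auto)
    qed
    fix c t :: real assume c: "1 \<le> c" and t: "0 \<le> t"
    show "PhiI \<phi> (c * t) \<le> c\<^sup>2 * PhiI \<phi> t"
    proof (cases "1 \<le> t")
      case True
      then have ct: "1 \<le> c * t" "t \<le> c * t" using c mult_mono[of 1 c 1 t] by auto
      have "(c * t)\<^sup>2 / I (c * t) \<le> (c * t)\<^sup>2 / I t"
        using Imono[of t "c * t"] ct Ipos[of t] True by (intro divide_left_mono) (auto intro: mult_pos_pos Ipos)
      then show ?thesis using P1[OF True] P1[OF ct(1)] by (simp add: power_mult_distrib)
    next
      case False
      have cc: "c \<le> c\<^sup>2" using c by (simp add: power2_eq_square)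
      show ?thesis
      proof (cases "c * t \<le> 1")
        case True
        then show ?thesis using P0[of "c * t"] P0[of t] False cc t Ipos[of 1]
          by (simp add: divide_right_mono mult_right_mono)
      next
        case False2: False
        have "(c * t)\<^sup>2 / I (c * t) \<le> (c * t)\<^sup>2 / I 1"
          using Imono[of 1 "c * t"] False2 Ipos[of 1] by (intro divide_left_mono) (auto intro: mult_pos_pos Ipos)
        also have "\<dots> \<le> c\<^sup>2 * t / I 1"
          using False t Ipos[of 1] by (intro divide_right_mono) (auto simp: power_mult_distrib power2_eq_square[of t] mult_left_le intro!: mult_left_mono)
        finally show ?thesis using P1[of "c * t"] P0[of t] False False2 by simp
      qed
    qed
  next
    fix y :: real
    define z where "z = max 1 y"
    have z: "z > 0" "y \<le> z" by (auto simp: z_def)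
    \<comment> \<open>Beyond a the integrand is below s / z, so I(t) is at most I(a) + t^2 / (2 z).
      Once t^2 also exceeds 2 z I(a), the quotient t^2 / I(t) exceeds z.\<close>
    obtain a where a: "a \<ge> 1" "2 * z < \<phi> a" using unb by blast
    define t where "t = max a (2 * z * I a + 1)"
    have t: "a \<le> t" "1 \<le> t" "2 * z * I a < t" using a by (auto simp: t_def)
    have "t \<le> t\<^sup>2" using t by (simp add: power2_eq_square)
    then have 1: "2 * z * I a < t\<^sup>2" using t by linarith
    have "I t \<le> I a + (t\<^sup>2 - a\<^sup>2) / \<phi> a" using Iup[of a t] a t by simp
    also have "(t\<^sup>2 - a\<^sup>2) / \<phi> a \<le> t\<^sup>2 / \<phi> a" using pos[of a] a by (intro divide_right_mono) auto
    also have "t\<^sup>2 / \<phi> a \<le> t\<^sup>2 / (2 * z)" using a z pos[of a] by (intro divide_left_mono) auto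
    finally have "2 * z * I t \<le> 2 * z * (I a + t\<^sup>2 / (2 * z))" using z by simp
    also have "\<dots> = 2 * z * I a + t\<^sup>2" using z by (simp add: field_simps)
    finally have "z * I t < t\<^sup>2" using 1 by simp
    then have "z < t\<^sup>2 / I t" using Ipos[of t] t by (simp add: pos_less_divide_eq)
    then have "z < PhiI \<phi> t" using P1[of t] t by simp
    then show "\<exists>t\<ge>0. y < PhiI \<phi> t" using z t by (intro exI[of _ t]) auto
  qed
  have "PhiI \<phi> t \<le> (1 / I 1) * t\<^sup>2" if "1 \<le> t" for t
    using P1[OF that] Imono[of 1 t] Ipos[of 1] that by (simp add: divide_left_mono mult_pos_pos Ipos)
  then show "\<exists>K>0. \<forall>t\<ge>1. PhiI \<phi> t \<le> K * t\<^sup>2" using Ipos[of 1] by (intro exI[of _ "1 / I 1"]) auto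
qed

section \<open>Adapted pairs of geometries\<close>

text \<open>Yields the length constants: one fixed auxiliary word for each of finitely many
  configurations.\<close>

lemma uniform_length_bound:
  assumes "finite Z" "\<And>z. z \<in> Z \<Longrightarrow> \<exists>v. Q z v"
  shows "\<exists>L::nat. \<forall>z\<in>Z. \<exists>v. Q z v \<and> f v \<le> L"
proof -
  have "\<forall>z\<in>Z. \<exists>v. Q z v" using assms(2) by blast
  from bchoice[OF this] obtain h where h: "\<forall>z\<in>Z. Q z (h z)" ..
  have "\<forall>z\<in>Z. f (h z) \<le> Max ((\<lambda>z. f (h z)) ` Z)" using assms(1) by (auto intro: Max_ge)
  then show ?thesis using h by blast
qed

lemma word_deg_simps [simp]: "word_deg s [] = 0"
  "word_deg s (x # w) = (if fst x = s then 1 else 0) + word_deg s w"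
  "word_deg s (w @ w') = word_deg s w + word_deg s w'"
  by (auto simp: word_deg_def)

lemma word_deg_le_length: "word_deg s w \<le> length w"
  by (auto simp: word_deg_def)

lemma word_deg_eq_0: "s \<notin> fst ` set w \<Longrightarrow> word_deg s w = 0"
  by (induction w) auto

lemma word_deg_concat_replicate: "word_deg s (concat (replicate n w)) = n * word_deg s w"
  by (induction n) auto

definition letter :: "('a, 'b) monoid_scheme \<Rightarrow> 'a \<times> bool \<Rightarrow> 'a" where
  "letter G x = (if snd x then fst x else inv\<^bsub>G\<^esub> (fst x))"

lemma word_eval_simps [simp]: "word_eval G [] = \<one>\<^bsub>G\<^esub>"
  "word_eval G (x # w) = letter G x \<otimes>\<^bsub>G\<^esub> word_eval G w"
  by (auto simp: word_eval_def letter_def split: prod.splits)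

context group
begin

lemma letter_closed [intro]: "fst x \<in> carrier G \<Longrightarrow> letter G x \<in> carrier G"
  by (auto simp: letter_def)

lemma word_eval_closed: "fst ` set w \<subseteq> carrier G \<Longrightarrow> word_eval G w \<in> carrier G"
  by (induction w) auto

lemma word_eval_append: "fst ` set w \<subseteq> carrier G \<Longrightarrow> fst ` set v \<subseteq> carrier G \<Longrightarrow>
    word_eval G (w @ v) = word_eval G w \<otimes> word_eval G v"
  by (induction w) (auto simp: word_eval_closed m_assoc letter_closed)

lemma word_eval_concat_replicate:
  "fst ` set w \<subseteq> carrier G \<Longrightarrow> word_eval G (concat (replicate n w)) = word_eval G w [^] n"
proof (induction n)
  case (Suc n)
  have "fst ` set (concat (replicate n w)) \<subseteq> carrier G" using Suc.prems by fastforce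
  then have "word_eval G (concat (replicate (Suc n) w)) = word_eval G w \<otimes> word_eval G w [^] n"
    using Suc by (simp add: word_eval_append)
  then show ?case using nat_pow_Suc2[OF word_eval_closed[OF Suc.prems]] by simp
qed simp

text \<open>The letters lie in Z and not only in R: the representative of z is z or its inverse, and
  Z is symmetric. This matters because the cost of a letter depends on the generating sets that
  contain it.\<close>

lemma reps_mod_inv_word:
  assumes gen: "fin_sym_gen G Z K" and reps: "reps_mod_inv G R (U - {\<one>})" and ZU: "Z \<subseteq> U"
    and h: "h \<in> K"
  shows "\<exists>v. fst ` set v \<subseteq> R \<inter> Z \<and> word_eval G v = h"
proof -
  have Z: "Z \<subseteq> carrier G" "\<And>z. z \<in> Z \<Longrightarrow> inv z \<in> Z" "generate G Z = K"
    using gen by (auto simp: fin_sym_gen_def)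
  have single: "\<exists>v. fst ` set v \<subseteq> R \<inter> Z \<and> word_eval G v = z" if z: "z \<in> Z" for z
  proof (cases "z = \<one>")
    case True
    then show ?thesis by (intro exI[of _ "[]"]) simp
  next
    case False
    then have "z \<in> U - {\<one>}" using z ZU by blast
    then obtain s where s: "s \<in> R" "s = z \<or> s = inv z"
      using reps unfolding reps_mod_inv_def by blast
    have zc: "z \<in> carrier G" using z Z by blast
    show ?thesis
      by (intro exI[of _ "[(s, s = z)]"]) (use s z zc Z(2) in \<open>auto simp: letter_def\<close>)
  qed
  have "h \<in> generate G Z" using h Z(3) by simp
  then show ?thesis
  proof (induction rule: generate.induct)
    case one
    then show ?case by (intro exI[of _ "[]"]) simp
  next
    case (eng h1 h2)
    then obtain v1 v2 where v: "fst ` set v1 \<subseteq> R \<inter> Z" "word_eval G v1 = h1"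
      "fst ` set v2 \<subseteq> R \<inter> Z" "word_eval G v2 = h2" by blast
    then have "fst ` set v1 \<subseteq> carrier G" "fst ` set v2 \<subseteq> carrier G" using Z(1) by blast+
    then show ?case using v by (intro exI[of _ "v1 @ v2"]) (auto simp: word_eval_append)
  qed (use single Z in blast)+
qed

end

text \<open>\<open>\<Psi>\<close> abstracts \<open>Phi \<phi>\<close>. By \<open>dominated\<close>,
  letters of \<open>S 0\<close> are the most expensive ones up to constants, because
  \<open>Phi0 t\<close> is t^2 for t >= 1.\<close>

locale adapted_pair = group G for G (structure) +
  fixes k :: nat and N :: "'a set" and m :: nat and u :: "nat \<Rightarrow> 'a" and S :: "nat \<Rightarrow> 'a set"
    and H :: "nat \<Rightarrow> 'a set" and Xi :: "nat \<Rightarrow> 'a set" and SG SN :: "'a set" and \<Psi> :: "nat \<Rightarrow> real \<Rightarrow> real"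
  assumes scale: "\<And>i. i \<le> k \<Longrightarrow> quadratic_scale (\<Psi> i)"
    and dominated: "\<And>i. i \<le> k \<Longrightarrow> \<exists>K>0. \<forall>t\<ge>1. \<Psi> i t \<le> K * \<Psi> 0 t"
    and N_normal: "N \<lhd> G" and N_nil: "nilpotent_subgroup G N"
    and u0: "u 0 = \<one>" and u_carr: "\<And>l. l \<le> m \<Longrightarrow> u l \<in> carrier G"
    and u_cover: "carrier G = (\<Union>l\<le>m. N #> u l)"
    and u_disj: "\<And>l l'. l \<le> m \<Longrightarrow> l' \<le> m \<Longrightarrow> l \<noteq> l' \<Longrightarrow> (N #> u l) \<inter> (N #> u l') = {}"
    and S0: "fin_sym_gen G (S 0) (carrier G)"
    and Si: "\<And>i. 1 \<le> i \<Longrightarrow> i \<le> k \<Longrightarrow> fin_sym_gen G (S i) (N \<inter> H i)"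
    and Xi0: "fin_sym_gen G (Xi 0) N"
    and Xi: "\<And>i. 1 \<le> i \<Longrightarrow> i \<le> k \<Longrightarrow> Xi i = (\<Union>l\<le>m. (\<lambda>s. u l \<otimes> s \<otimes> inv (u l)) ` S i)"
    and SG: "reps_mod_inv G SG ((\<Union>i\<le>k. S i) - {\<one>})"
    and SN: "reps_mod_inv G SN ((\<Union>i\<le>k. Xi i) - {\<one>})"
begin

text \<open>Up to a constant factor, \<open>F\<^sub>s\<^sup>-\<^sup>1(x) \<le> r\<close> for the weight function \<open>F\<^sub>s\<close>
  (see \<open>inv_weight_bounds\<close>).\<close>

definition affordable :: "(nat \<Rightarrow> 'a set) \<Rightarrow> 'a \<Rightarrow> real \<Rightarrow> real \<Rightarrow> bool" where
  "affordable A s x r \<longleftrightarrow> (\<exists>j\<le>k. s \<in> A j \<and> \<Psi> j x \<le> r)"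

lemma affordable_mono: "affordable A s x r \<Longrightarrow> 0 \<le> y \<Longrightarrow> y \<le> x \<Longrightarrow> r \<le> r' \<Longrightarrow> affordable A s y r'"
  unfolding affordable_def using quadratic_scaleD(3)[OF scale] by (meson order_trans)

lemma affordable_scale: "affordable A s x r \<Longrightarrow> 0 \<le> x \<Longrightarrow> 1 \<le> c \<Longrightarrow> affordable A s (c * x) (c\<^sup>2 * r)"
  unfolding affordable_def using quadratic_scaleD(4)[OF scale, of _ c x]
  by (meson mult_left_mono order_trans zero_le_power2)

text \<open>The two bounds may have different witnesses j, so the sum is compared with twice the
  larger argument, whose witness then serves alone; 4 = 2^2.\<close>

lemma affordable_add:
  assumes "affordable A s x r" "affordable A s y r" "0 \<le> x" "0 \<le> y"
  shows "affordable A s (x + y) (4 * r)"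
proof -
  have "affordable A s (max x y) r" using assms by (auto simp: max_def)
  from affordable_scale[OF this, of 2] have "affordable A s (2 * max x y) (4 * r)" using assms by simp
  then show ?thesis by (rule affordable_mono) (use assms in auto)
qed

lemma affordable_0: "i \<le> k \<Longrightarrow> s \<in> A i \<Longrightarrow> 0 \<le> r \<Longrightarrow> affordable A s 0 r"
  unfolding affordable_def using quadratic_scaleD(6)[OF scale] by auto

lemma affordable_nonneg: "affordable A s x r \<Longrightarrow> 0 \<le> x \<Longrightarrow> 0 \<le> r"
  unfolding affordable_def using quadratic_scaleD(7)[OF scale] by (meson order_trans)

lemma affordable_sum:
  assumes "finite B" "\<And>b. b \<in> B \<Longrightarrow> affordable A s (f b) r" "\<And>b. b \<in> B \<Longrightarrow> 0 \<le> f b"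
    "i \<le> k" "s \<in> A i" "0 \<le> r"
  shows "affordable A s (\<Sum>b\<in>B. f b) (4 ^ card B * r)"
  using assms(1-3)
proof (induction B)
  case (insert b B)
  have "affordable A s (sum f B) (4 ^ card B * r)" using insert by auto
  moreover have "1 * r \<le> 4 ^ card B * r" using assms(6) by (intro mult_right_mono) auto
  then have "affordable A s (f b) (4 ^ card B * r)"
    using insert.prems by (intro affordable_mono[OF insert.prems(1)]) auto
  ultimately have "affordable A s (f b + sum f B) (4 * (4 ^ card B * r))"
    using insert by (intro affordable_add) (auto intro: sum_nonneg)
  then show ?case using insert by (simp add: mult.assoc)
qed (use affordable_0[of i s A] assms in auto)

lemma N_subgroup: "subgroup N G" and N_carrier: "N \<subseteq> carrier G"
proof -
  show "subgroup N G" using N_normal by (rule normal_imp_subgroup)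
  then show "N \<subseteq> carrier G" by (rule subgroup.subset)
qed

lemma S_carrier: "i \<le> k \<Longrightarrow> S i \<subseteq> carrier G" and S_finite: "i \<le> k \<Longrightarrow> finite (S i)"
  and S_inv: "i \<le> k \<Longrightarrow> s \<in> S i \<Longrightarrow> inv s \<in> S i"
  using S0 Si[of i] by (cases "i = 0"; auto simp: fin_sym_gen_def Suc_le_eq)+

lemma S_N: "1 \<le> i \<Longrightarrow> i \<le> k \<Longrightarrow> S i \<subseteq> N"
  using Si[of i] by (auto simp: fin_sym_gen_def intro: generate.incl)

lemma Xi_N: "i \<le> k \<Longrightarrow> Xi i \<subseteq> N"
proof (cases "i = 0")
  case True
  then show ?thesis using Xi0 by (auto simp: fin_sym_gen_def intro: generate.incl)
next
  case False
  assume "i \<le> k"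
  then show ?thesis using False S_N[of i] Xi[of i] u_carr normal.inv_op_closed2[OF N_normal] by auto
qed

lemma conj_inv:
  "l \<le> m \<Longrightarrow> s \<in> carrier G \<Longrightarrow> inv (u l \<otimes> s \<otimes> inv (u l)) = u l \<otimes> inv s \<otimes> inv (u l)"
  using u_carr by (simp add: inv_mult_group m_assoc)

lemma Xi_inv: "i \<le> k \<Longrightarrow> s \<in> Xi i \<Longrightarrow> inv s \<in> Xi i"
proof (cases "i = 0")
  case True
  then show "s \<in> Xi i \<Longrightarrow> inv s \<in> Xi i" using Xi0 by (auto simp: fin_sym_gen_def)
next
  case False
  assume i: "i \<le> k" "s \<in> Xi i"
  then obtain l t where "l \<le> m" "t \<in> S i" "s = u l \<otimes> t \<otimes> inv (u l)" using False Xi[of i] by auto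
  then have "inv s = u l \<otimes> inv t \<otimes> inv (u l)" "inv t \<in> S i"
    using conj_inv S_carrier[OF i(1)] S_inv[OF i(1)] by auto
  then show ?thesis using False i(1) Xi[of i] \<open>l \<le> m\<close> by auto
qed

lemma Xi_finite: "i \<le> k \<Longrightarrow> finite (Xi i)"
  using Xi0 Xi[of i] S_finite[of i] by (cases "i = 0") (auto simp: fin_sym_gen_def)

lemma SG_sub: "SG \<subseteq> (\<Union>i\<le>k. S i)" and SN_sub: "SN \<subseteq> (\<Union>i\<le>k. Xi i)"
  using SG SN unfolding reps_mod_inv_def by blast+

lemma SG_finite: "finite SG" and SN_finite: "finite SN"
  using finite_subset[OF SG_sub] finite_subset[OF SN_sub] S_finite Xi_finite by auto

lemma SG_carrier: "SG \<subseteq> carrier G" and SN_N: "SN \<subseteq> N" and SN_carrier: "SN \<subseteq> carrier G"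
  using SG_sub SN_sub S_carrier Xi_N N_carrier by blast+

section \<open>From words over G to words over N\<close>

text \<open>The letter \<open>x\<close> is never more expensive for N, up to a constant, than \<open>s\<close> is for G.\<close>

definition replaceable :: "'a \<Rightarrow> 'a \<Rightarrow> bool" where
  "replaceable s x \<longleftrightarrow> (if \<exists>i. 1 \<le> i \<and> i \<le> k \<and> s \<in> S i then \<forall>j. 1 \<le> j \<longrightarrow> j \<le> k \<longrightarrow> s \<in> S j \<longrightarrow> x \<in> Xi j
     else x \<in> Xi 0)"

text \<open>A witness j >= 1 for s also serves for x. The delicate case is j = 0 for a letter that
  lies in some \<open>S i\<close> with i >= 1 as well: x need not belong to \<open>Xi 0\<close>, and
  domination passes to the witness i.\<close>

lemma replaceable_affordable:
  obtains K where "1 \<le> K" "\<And>s x n r. replaceable s x \<Longrightarrow> affordable S s (real n) r \<Longrightarrow> affordable Xi x (real n) (K * r)"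
proof -
  have "\<forall>i\<in>{..k}. \<exists>K>0. \<forall>t\<ge>1. \<Psi> i t \<le> K * \<Psi> 0 t" using dominated by blast
  from bchoice[OF this] obtain Kf where Kf: "\<forall>i\<in>{..k}. Kf i > 0 \<and> (\<forall>t\<ge>1. \<Psi> i t \<le> Kf i * \<Psi> 0 t)" ..
  define K where "K = 1 + (\<Sum>i\<le>k. Kf i)"
  have K1: "1 \<le> K" unfolding K_def using Kf by (auto intro!: sum_nonneg intro: less_imp_le)
  have Kf_le: "Kf i \<le> K" if "i \<le> k" for i
  proof -
    have "Kf i \<le> (\<Sum>i\<le>k. Kf i)" using Kf that by (intro member_le_sum) (auto intro: less_imp_le)
    then show ?thesis by (simp add: K_def)
  qed
  have "affordable Xi x (real n) (K * r)" if replaceable: "replaceable s x" and ad: "affordable S s (real n) r" for s x n r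
  proof -
    have r: "0 \<le> r" using ad by (rule affordable_nonneg) simp
    then have rK: "r \<le> K * r" using K1 mult_right_mono[of 1 K r] by simp
    obtain j where j: "j \<le> k" "s \<in> S j" "\<Psi> j (real n) \<le> r" using ad unfolding affordable_def by blast
    show ?thesis
    proof (cases "\<exists>i. 1 \<le> i \<and> i \<le> k \<and> s \<in> S i")
      case False
      then have "j = 0" using j by (cases j) auto
      then show ?thesis using False replaceable j rK unfolding replaceable_def affordable_def by (intro exI[of _ 0]) auto
    next
      case True
      then have x: "\<And>j. 1 \<le> j \<Longrightarrow> j \<le> k \<Longrightarrow> s \<in> S j \<Longrightarrow> x \<in> Xi j" using replaceable unfolding replaceable_def by auto
      show ?thesis
      proof (cases "j = 0")
        case False
        then show ?thesis using x[of j] j rK unfolding affordable_def by (intro exI[of _ j]) auto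
      next
        case j0: True
        obtain i where i: "1 \<le> i" "i \<le> k" "s \<in> S i" using True by blast
        have "\<Psi> i (real n) \<le> K * r"
        proof (cases "n = 0")
          case True
          then show ?thesis using quadratic_scaleD(6)[OF scale[OF i(2)]] r rK by simp
        next
          case False
          then have "\<Psi> i (real n) \<le> Kf i * \<Psi> 0 (real n)" using Kf i by simp
          also have "\<dots> \<le> K * r" using Kf_le[OF i(2)] Kf i j j0 K1 quadratic_scaleD(7)[OF scale, of 0 "real n"]
            by (intro mult_mono) auto
          finally show ?thesis .
        qed
        then show ?thesis using x[OF i] i unfolding affordable_def by (intro exI[of _ i]) auto
      qed
    qed
  qed
  then show thesis using that[of K] K1 by blast
qed

lemma letter_step:
  assumes s: "s \<in> SG" and l: "l \<le> m"
  shows "\<exists>v. fst ` set v \<subseteq> SN \<inter> {x. replaceable s x} \<and> (\<exists>l'\<le>m. u l \<otimes> letter G (s, b) = word_eval G v \<otimes> u l')"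
proof (cases "\<exists>i. 1 \<le> i \<and> i \<le> k \<and> s \<in> S i")
  case True
  then obtain i where i: "1 \<le> i" "i \<le> k" "s \<in> S i" by blast
  define a where "a = letter G (s, b)"
  have sc: "s \<in> carrier G" using s SG_carrier by blast
  have aS: "a \<in> S j \<and> inv a \<in> S j" if "j \<le> k" "s \<in> S j" for j
    using that S_inv[OF that] sc by (auto simp: a_def letter_def)
  have ac: "a \<in> carrier G" using sc by (auto simp: a_def)
  define x where "x = u l \<otimes> a \<otimes> inv (u l)"
  have xinv: "inv x = u l \<otimes> inv a \<otimes> inv (u l)" unfolding x_def using conj_inv l ac by blast
  have xX: "x \<in> Xi j \<and> inv x \<in> Xi j" if "1 \<le> j" "j \<le> k" "s \<in> S j" for j
    unfolding xinv unfolding x_def using Xi[OF that(1,2)] aS[OF that(2,3)] l by auto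
  have xc: "x \<in> carrier G" using ac u_carr[OF l] by (simp add: x_def)
  \<comment> \<open>The conjugated letter must be nontrivial, since \<open>SN\<close> represents
    nontrivial elements only.\<close>
  have "s \<noteq> \<one>" using s SG unfolding reps_mod_inv_def by blast
  then have "a \<noteq> \<one>" using sc by (auto simp: a_def letter_def inv_eq_1_iff)
  moreover have ul: "u l \<otimes> a = x \<otimes> u l" unfolding x_def using ac u_carr[OF l] by (simp add: m_assoc)
  have "a = inv (u l) \<otimes> (x \<otimes> u l)" unfolding ul[symmetric] using ac u_carr[OF l] by simp
  ultimately have "x \<noteq> \<one>" using u_carr[OF l] by auto
  then have "x \<in> (\<Union>i\<le>k. Xi i) - {\<one>}" using xX[OF i] i by auto
  then obtain y where y: "y \<in> SN" "y = x \<or> y = inv x" using SN unfolding reps_mod_inv_def by blast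
  have "replaceable s y" using True y xX by (auto simp: replaceable_def)
  moreover have "word_eval G [(y, y = x)] = x" using y xc by (auto simp: letter_def)
  ultimately show ?thesis using y l ul unfolding a_def by (intro exI[of _ "[(y, y = x)]"]) auto
next
  case False
  have "u l \<otimes> letter G (s, b) \<in> carrier G" using s u_carr[OF l] SG_carrier by (intro m_closed letter_closed) auto
  then obtain l' h where h: "l' \<le> m" "h \<in> N" "u l \<otimes> letter G (s, b) = h \<otimes> u l'"
    using u_cover unfolding r_coset_def by auto
  have "Xi 0 \<subseteq> (\<Union>i\<le>k. Xi i)" by auto
  from reps_mod_inv_word[OF Xi0 SN this h(2)] obtain v where v: "fst ` set v \<subseteq> SN \<inter> Xi 0" "word_eval G v = h"
    by blast
  have "SN \<inter> Xi 0 \<subseteq> SN \<inter> {x. replaceable s x}" using False by (auto simp: replaceable_def)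
  then show ?thesis using v h by (intro exI[of _ v]) auto
qed

text \<open>One length L serves all letters, signs and cosets, as there are finitely many. A letter
  x is produced only by letters s that it may replace, so its degree is at most L times their
  number. The starting coset is arbitrary for the induction.\<close>

lemma coset_walk:
  obtains L :: nat where "\<And>w l. fst ` set w \<subseteq> SG \<Longrightarrow> l \<le> m \<Longrightarrow>
    \<exists>v l'. l' \<le> m \<and> fst ` set v \<subseteq> SN \<and> u l \<otimes> word_eval G w = word_eval G v \<otimes> u l' \<and>
      (\<forall>x. word_deg x v \<le> L * (\<Sum>s\<in>{s\<in>SG. replaceable s x}. word_deg s w))"
proof -
  define Q where "Q = (\<lambda>(s, b, l) v. fst ` set v \<subseteq> SN \<inter> {x. replaceable s x} \<and>
    (\<exists>l'\<le>m. u l \<otimes> letter G (s, b) = word_eval G v \<otimes> u l'))"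
  have "\<exists>L::nat. \<forall>z\<in>SG \<times> (UNIV :: bool set) \<times> {..m}. \<exists>v. Q z v \<and> length v \<le> L"
    using letter_step SG_finite by (intro uniform_length_bound) (auto simp: Q_def)
  then obtain L where L: "\<And>z. z \<in> SG \<times> (UNIV :: bool set) \<times> {..m} \<Longrightarrow> \<exists>v. Q z v \<and> length v \<le> L" by blast
  have "\<exists>v l'. l' \<le> m \<and> fst ` set v \<subseteq> SN \<and> u l \<otimes> word_eval G w = word_eval G v \<otimes> u l' \<and>
      (\<forall>x. word_deg x v \<le> L * (\<Sum>s\<in>{s\<in>SG. replaceable s x}. word_deg s w))"
    if "fst ` set w \<subseteq> SG" "l \<le> m" for w l
    using that
  proof (induction w arbitrary: l)
    case Nil
    then show ?case using u_carr by (intro exI[of _ "[]"] exI[of _ l]) auto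
  next
    case (Cons x w)
    obtain s b where x: "x = (s, b)" by force
    have s: "s \<in> SG" using Cons.prems x by auto
    obtain v1 where v1: "Q (s, b, l) v1" "length v1 \<le> L" using L[of "(s, b, l)"] s Cons.prems by auto
    then obtain l1 where l1: "l1 \<le> m" "u l \<otimes> letter G (s, b) = word_eval G v1 \<otimes> u l1"
      and v1s: "fst ` set v1 \<subseteq> SN" "fst ` set v1 \<subseteq> {x. replaceable s x}" by (auto simp: Q_def)
    obtain v2 l2 where v2: "l2 \<le> m" "fst ` set v2 \<subseteq> SN" "u l1 \<otimes> word_eval G w = word_eval G v2 \<otimes> u l2"
      "\<And>x. word_deg x v2 \<le> L * (\<Sum>s\<in>{s\<in>SG. replaceable s x}. word_deg s w)"
      using Cons.IH[OF _ l1(1)] Cons.prems by auto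
    have vc: "fst ` set v1 \<subseteq> carrier G" "fst ` set v2 \<subseteq> carrier G" "fst ` set w \<subseteq> carrier G"
      using v1s v2 Cons.prems SN_carrier SG_carrier by auto
    note c = word_eval_closed[OF vc(1)] word_eval_closed[OF vc(2)] word_eval_closed[OF vc(3)]
      u_carr[OF l1(1)] u_carr[OF v2(1)] u_carr[OF Cons.prems(2)]
    have lc: "letter G (s, b) \<in> carrier G" using s SG_carrier by (auto intro!: letter_closed)
    have "u l \<otimes> word_eval G (x # w) = (u l \<otimes> letter G (s, b)) \<otimes> word_eval G w"
      using c lc x by (simp add: m_assoc)
    also have "\<dots> = word_eval G v1 \<otimes> (u l1 \<otimes> word_eval G w)" using c l1 by (simp add: m_assoc)
    also have "\<dots> = word_eval G (v1 @ v2) \<otimes> u l2" using c vc v2(3) by (simp add: word_eval_append m_assoc)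
    finally have ev: "u l \<otimes> word_eval G (x # w) = word_eval G (v1 @ v2) \<otimes> u l2" .
    have deg: "word_deg y (v1 @ v2) \<le> L * (\<Sum>s\<in>{s\<in>SG. replaceable s y}. word_deg s (x # w))" for y
    proof -
      have fin: "finite {s\<in>SG. replaceable s y}" using SG_finite by simp
      have sum: "(\<Sum>s'\<in>{s\<in>SG. replaceable s y}. word_deg s' (x # w))
          = (if replaceable s y then 1 else 0) + (\<Sum>s\<in>{s\<in>SG. replaceable s y}. word_deg s w)"
        using s fin by (simp add: x sum.distrib)
      have "word_deg y v1 \<le> L * (if replaceable s y then 1 else 0)"
        using v1s(2) word_deg_le_length[of y v1] v1(2) by (auto intro: word_deg_eq_0)
      then show ?thesis unfolding sum using v2(4)[of y] by (simp add: add_mult_distrib2)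
    qed
    show ?case using ev deg v1s v2 by (intro exI[of _ "v1 @ v2"] exI[of _ l2]) auto
  qed
  then show thesis using that[of L] by blast
qed

lemma G_to_N:
  obtains C where "1 \<le> C" "\<And>w r. fst ` set w \<subseteq> SG \<Longrightarrow> word_eval G w \<in> N \<Longrightarrow> 0 \<le> r \<Longrightarrow>
     (\<And>s. s \<in> SG \<Longrightarrow> affordable S s (word_deg s w) r) \<Longrightarrow>
     \<exists>v. fst ` set v \<subseteq> SN \<and> word_eval G v = word_eval G w \<and> (\<forall>x\<in>SN. affordable Xi x (word_deg x v) (C * r))"
proof -
  obtain K where K: "1 \<le> K" "\<And>s x n r. replaceable s x \<Longrightarrow> affordable S s (real n) r \<Longrightarrow> affordable Xi x (real n) (K * r)"
    by (rule replaceable_affordable) blast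
  obtain L :: nat where L: "\<And>w l. fst ` set w \<subseteq> SG \<Longrightarrow> l \<le> m \<Longrightarrow>
    \<exists>v l'. l' \<le> m \<and> fst ` set v \<subseteq> SN \<and> u l \<otimes> word_eval G w = word_eval G v \<otimes> u l' \<and>
      (\<forall>x. word_deg x v \<le> L * (\<Sum>s\<in>{s\<in>SG. replaceable s x}. word_deg s w))"
    by (rule coset_walk) blast
  define L' where "L' = real L + 1"
  \<comment> \<open>K comes from replacing letters, each of the at most \<open>card SG\<close> added
    degrees costs a factor 4, and stretching degrees by L' costs its square. L' exceeds L so as to
    be at least 1.\<close>
  define C where "C = L'\<^sup>2 * (4 ^ card SG * K)"
  have L': "1 \<le> L'" by (simp add: L'_def)
  have "1 \<le> 4 ^ card SG * K" using K(1) mult_mono[of 1 "4 ^ card SG" 1 K] by simp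
  then have "1 \<le> C" unfolding C_def using L' mult_mono[of 1 "L'\<^sup>2" 1 "4 ^ card SG * K"] by simp
  moreover have "\<exists>v. fst ` set v \<subseteq> SN \<and> word_eval G v = word_eval G w \<and> (\<forall>x\<in>SN. affordable Xi x (word_deg x v) (C * r))"
    if w: "fst ` set w \<subseteq> SG" "word_eval G w \<in> N" and r: "0 \<le> r" "\<And>s. s \<in> SG \<Longrightarrow> affordable S s (word_deg s w) r" for w r
  proof -
    obtain v l' where v: "l' \<le> m" "fst ` set v \<subseteq> SN" "u 0 \<otimes> word_eval G w = word_eval G v \<otimes> u l'"
      "\<And>x. word_deg x v \<le> L * (\<Sum>s\<in>{s\<in>SG. replaceable s x}. word_deg s w)"
      using L[OF w(1), of 0] by auto
    have wc: "word_eval G w \<in> carrier G" using w(2) N_carrier by blast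
    have vN: "word_eval G v \<in> N" using v(2)
    proof (induction v)
      case Nil
      then show ?case using N_subgroup by (simp add: subgroup.one_closed)
    next
      case (Cons x v)
      then have "letter G x \<in> N" using SN_N N_subgroup by (auto simp: letter_def intro: subgroup.m_inv_closed)
      then show ?case using Cons N_subgroup by (auto intro: subgroup.m_closed)
    qed
    have e: "word_eval G w = word_eval G v \<otimes> u l'" using v(3) wc u0 by simp
    \<comment> \<open>Both the given value and the value of v lie in N, so the walk ends in the
      coset N itself.\<close>
    have "l' = 0"
    proof (rule ccontr)
      assume "l' \<noteq> 0"
      moreover have "word_eval G w \<in> N #> u l'" using e vN by (auto simp: r_coset_def)
      moreover have "word_eval G w \<in> N #> u 0" using w(2) wc u0 by (auto simp: r_coset_def intro!: bexI[of _ "word_eval G w"])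
      ultimately show False using u_disj[of l' 0] v(1) by blast
    qed
    then have e: "word_eval G v = word_eval G w" using e u0 vN N_carrier by (simp add: subsetD)
    have "affordable Xi x (word_deg x v) (C * r)" if x: "x \<in> SN" for x
    proof -
      let ?B = "{s\<in>SG. replaceable s x}"
      obtain i where i: "i \<le> k" "x \<in> Xi i" using x SN_sub by auto
      have "affordable Xi x (\<Sum>s\<in>?B. real (word_deg s w)) (4 ^ card ?B * (K * r))"
        by (rule affordable_sum) (use i SG_finite K r in auto)
      then have "affordable Xi x (L' * (\<Sum>s\<in>?B. real (word_deg s w))) (L'\<^sup>2 * (4 ^ card ?B * (K * r)))"
        by (rule affordable_scale) (use L' in \<open>auto intro: sum_nonneg\<close>)
      then show ?thesis
      proof (rule affordable_mono)
        have "real (word_deg x v) \<le> real L * (\<Sum>s\<in>?B. real (word_deg s w))"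
          using v(4)[of x] by (simp flip: of_nat_sum of_nat_mult)
        also have "\<dots> \<le> L' * (\<Sum>s\<in>?B. real (word_deg s w))"
          by (intro mult_right_mono sum_nonneg) (auto simp: L'_def)
        finally show "real (word_deg x v) \<le> L' * (\<Sum>s\<in>?B. real (word_deg s w))" .
        have "(4::real) ^ card ?B \<le> 4 ^ card SG" using SG_finite by (intro power_increasing card_mono) auto
        then have "L'\<^sup>2 * (4 ^ card ?B * (K * r)) \<le> L'\<^sup>2 * (4 ^ card SG * (K * r))"
          using K r by (intro mult_left_mono mult_right_mono) auto
        then show "L'\<^sup>2 * (4 ^ card ?B * (K * r)) \<le> C * r" by (simp add: C_def mult.assoc)
      qed simp
    qed
    then show ?thesis using v(2) e by (intro exI[of _ v]) auto
  qed
  ultimately show thesis using that[of C] by blast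
qed

end

section \<open>From words over N to words over G\<close>

context adapted_pair
begin

text \<open>Only the word \<open>v0\<close> for s, with letters in \<open>S i\<close>, is repeated n
  times; the words for u_l and its inverse occur once and account for the additive constant. For i =
  0 there is no conjugation.\<close>

lemma power_block:
  obtains L :: nat where "1 \<le> L" "\<And>i x n. i \<le> k \<Longrightarrow> x \<in> Xi i \<Longrightarrow>
    \<exists>v. fst ` set v \<subseteq> SG \<and> word_eval G v = x [^] (n::nat) \<and>
      (\<forall>s. word_deg s v \<le> L + (if s \<in> S i then L * n else 0))"
proof -
  define Q where "Q = (\<lambda>(i, x) (v1, v0, v2). fst ` set v1 \<subseteq> SG \<and> fst ` set v0 \<subseteq> SG \<inter> S i \<and>
    fst ` set v2 \<subseteq> SG \<and> (\<forall>n::nat. x [^] n = word_eval G v1 \<otimes> word_eval G v0 [^] n \<otimes> word_eval G v2))"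
  define f where "f = (\<lambda>(v1 :: ('a \<times> bool) list, v0 :: ('a \<times> bool) list, v2 :: ('a \<times> bool) list).
    length v1 + length v0 + length v2)"
  have wG: "\<exists>v. fst ` set v \<subseteq> SG \<and> word_eval G v = g" if "g \<in> carrier G" for g
    using reps_mod_inv_word[OF S0 SG _ that] by auto
  have Q: "\<exists>v. Q (i, x) v" if i: "i \<le> k" and x: "x \<in> Xi i" for i x
  proof (cases "i = 0")
    case True
    have xc: "x \<in> carrier G" using Xi_N[OF i] x N_carrier by blast
    have "S 0 \<subseteq> (\<Union>i\<le>k. S i)" by auto
    from reps_mod_inv_word[OF S0 SG this xc] obtain v where "fst ` set v \<subseteq> SG \<inter> S 0" "word_eval G v = x"
      by blast
    then show ?thesis using True xc by (intro exI[of _ "([], v, [])"]) (simp add: Q_def)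
  next
    case False
    then obtain l s where l: "l \<le> m" "s \<in> S i" "x = u l \<otimes> s \<otimes> inv (u l)" using Xi[of i] x i by auto
    have gen: "fin_sym_gen G (S i) (N \<inter> H i)" using Si[of i] i False by simp
    then have "s \<in> N \<inter> H i" using l(2) by (auto simp: fin_sym_gen_def intro: generate.incl)
    moreover have "S i \<subseteq> (\<Union>i\<le>k. S i)" using i by auto
    ultimately obtain v0 where v0: "fst ` set v0 \<subseteq> SG \<inter> S i" "word_eval G v0 = s"
      using reps_mod_inv_word[OF gen SG] by blast
    obtain v1 where v1: "fst ` set v1 \<subseteq> SG" "word_eval G v1 = u l" using wG u_carr[OF l(1)] by blast
    obtain v2 where v2: "fst ` set v2 \<subseteq> SG" "word_eval G v2 = inv (u l)" using wG u_carr[OF l(1)] by blast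
    have c: "u l \<in> carrier G" "s \<in> carrier G" using u_carr[OF l(1)] S_carrier[OF i] l(2) by auto
    have "x [^] n = u l \<otimes> s [^] n \<otimes> inv (u l)" for n :: nat
    proof (induction n)
      case (Suc n)
      then show ?case using c l(3) by (simp add: m_assoc)
    qed (use c in simp)
    then show ?thesis using v0 v1 v2 by (intro exI[of _ "(v1, v0, v2)"]) (simp add: Q_def)
  qed
  have "\<exists>L::nat. \<forall>z\<in>Sigma {..k} Xi. \<exists>v. Q z v \<and> f v \<le> L"
    using Q Xi_finite by (intro uniform_length_bound finite_SigmaI) auto
  then obtain L where L: "\<And>i x. i \<le> k \<Longrightarrow> x \<in> Xi i \<Longrightarrow> \<exists>v. Q (i, x) v \<and> f v \<le> L" by blast
  have "\<exists>v. fst ` set v \<subseteq> SG \<and> word_eval G v = x [^] n \<and>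
      (\<forall>s. word_deg s v \<le> Suc L + (if s \<in> S i then Suc L * n else 0))"
    if i: "i \<le> k" and x: "x \<in> Xi i" for i x and n :: nat
  proof -
    obtain vs where vs: "Q (i, x) vs" "f vs \<le> L" using L[OF i x] by blast
    obtain v1 v0 v2 where v: "vs = (v1, v0, v2)" by (rule prod_cases3)
    have s: "fst ` set v1 \<subseteq> SG" "fst ` set v0 \<subseteq> SG \<inter> S i" "fst ` set v2 \<subseteq> SG"
      and e: "x [^] n = word_eval G v1 \<otimes> word_eval G v0 [^] n \<otimes> word_eval G v2"
      and len: "length v1 + length v0 + length v2 \<le> L"
      using vs by (auto simp: Q_def f_def v)
    define v where "v = v1 @ concat (replicate n v0) @ v2"
    have sr: "fst ` set (concat (replicate n v0)) \<subseteq> SG" using s(2) by fastforce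
    have c: "fst ` set v1 \<subseteq> carrier G" "fst ` set v0 \<subseteq> carrier G" "fst ` set v2 \<subseteq> carrier G"
      "fst ` set (concat (replicate n v0)) \<subseteq> carrier G"
      using s sr SG_carrier by blast+
    have "fst ` set (concat (replicate n v0) @ v2) \<subseteq> carrier G" using c by (auto simp: image_Un)
    then have "word_eval G v = word_eval G v1 \<otimes> (word_eval G (concat (replicate n v0)) \<otimes> word_eval G v2)"
      unfolding v_def using c by (simp only: word_eval_append)
    also have "\<dots> = x [^] n"
      unfolding e word_eval_concat_replicate[OF c(2)] using c by (simp add: word_eval_closed m_assoc)
    finally have ev: "word_eval G v = x [^] n" .
    have "word_deg y v \<le> Suc L + (if y \<in> S i then Suc L * n else 0)" for y
    proof -
      have "word_deg y v1 + word_deg y v2 \<le> Suc L"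
        using word_deg_le_length[of y v1] word_deg_le_length[of y v2] len by linarith
      moreover have "n * word_deg y v0 \<le> (if y \<in> S i then Suc L * n else 0)"
      proof (cases "y \<in> S i")
        case True
        have "word_deg y v0 \<le> Suc L" using word_deg_le_length[of y v0] len by linarith
        then show ?thesis using True by (simp add: mult.commute del: mult_Suc mult_Suc_right)
      next
        case False
        then have "word_deg y v0 = 0" using s(2) by (intro word_deg_eq_0) blast
        then show ?thesis by simp
      qed
      ultimately show ?thesis by (simp add: v_def word_deg_concat_replicate del: mult_Suc mult_Suc_right)
    qed
    moreover have "fst ` set v \<subseteq> SG" using s sr unfolding v_def by (simp add: image_Un)
    ultimately show ?thesis using ev by blast
  qed
  then show thesis using that[of "Suc L"] by simp
qed

text \<open>The bound on all \<open>\<Psi> j 1\<close> pays for the boundedly many letters that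
  spell coset representatives, whatever generating sets they belong to.\<close>

lemma power_prod_word:
  obtains L where "1 \<le> L" "\<And>ps r. (\<And>x n. (x, n) \<in> set ps \<Longrightarrow> affordable Xi x (real n) r) \<Longrightarrow>
      (\<And>j. j \<le> k \<Longrightarrow> \<Psi> j 1 \<le> r) \<Longrightarrow> 
    \<exists>v. fst ` set v \<subseteq> SG \<and> word_eval G v = power_prod G ps \<and>
      (\<forall>s\<in>SG. affordable S s (word_deg s v) (4 ^ length ps * (L * r)))"
proof -
  obtain L :: nat where L: "1 \<le> L" "\<And>i x n. i \<le> k \<Longrightarrow> x \<in> Xi i \<Longrightarrow>
    \<exists>v. fst ` set v \<subseteq> SG \<and> word_eval G v = x [^] (n::nat) \<and>
      (\<forall>s. word_deg s v \<le> L + (if s \<in> S i then L * n else 0))" by (rule power_block) blast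
  \<comment> \<open>Degrees are at most L (n + 1): adding 1 to n costs 4, and the factor L costs its
    square.\<close>
  define M where "M = (real L)\<^sup>2 * 4"
  have "1 \<le> real L" using L(1) by simp
  then have M: "1 \<le> M" unfolding M_def using one_le_power[of "real L" 2] by linarith
  have "\<exists>v. fst ` set v \<subseteq> SG \<and> word_eval G v = power_prod G ps \<and>
      (\<forall>s\<in>SG. affordable S s (word_deg s v) (4 ^ length ps * (M * r)))"
    if "\<And>x n. (x, n) \<in> set ps \<Longrightarrow> affordable Xi x (real n) r" and one: "\<And>j. j \<le> k \<Longrightarrow> \<Psi> j 1 \<le> r" for ps r
    using that(1)
  proof (induction ps)
    case Nil
    have "0 \<le> r" using one[of 0] quadratic_scaleD(1)[OF scale[of 0]] by simp
    then have "affordable S s 0 (M * r)" if "s \<in> SG" for s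
      using that SG_sub M affordable_0[of _ s S "M * r"] by auto
    then show ?case by (intro exI[of _ "[]"]) simp
  next
    case (Cons p ps)
    have r: "0 \<le> r" using one[of 0] quadratic_scaleD(1)[OF scale[of 0]] by simp
    obtain x n where p: "p = (x, n)" by force
    obtain i where i: "i \<le> k" "x \<in> Xi i" "\<Psi> i (real n) \<le> r" using Cons.prems[of x n] p unfolding affordable_def by auto
    obtain v where v: "fst ` set v \<subseteq> SG" "word_eval G v = x [^] n"
      "\<And>s. word_deg s v \<le> L + (if s \<in> S i then L * n else 0)" using L(2)[OF i(1,2), of n] by blast
    have "\<exists>v'. fst ` set v' \<subseteq> SG \<and> word_eval G v' = power_prod G ps \<and>
      (\<forall>s\<in>SG. affordable S s (word_deg s v') (4 ^ length ps * (M * r)))" by (rule Cons.IH) (use Cons.prems in auto)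
    then obtain v' where v': "fst ` set v' \<subseteq> SG" "word_eval G v' = power_prod G ps"
      "\<And>s. s \<in> SG \<Longrightarrow> affordable S s (word_deg s v') (4 ^ length ps * (M * r))" by blast
    have ad: "affordable S s (word_deg s v) (M * r)" if s: "s \<in> SG" for s
    proof (cases "s \<in> S i")
      case True
      have "affordable S s (real n) r" "affordable S s 1 r" using True i one unfolding affordable_def by blast+
      then have "affordable S s (real n + 1) (4 * r)" by (rule affordable_add) auto
      then have "affordable S s (real L * (real n + 1)) ((real L)\<^sup>2 * (4 * r))"
        by (rule affordable_scale) (use L(1) in auto)
      then show ?thesis
      proof (rule affordable_mono)
        have "real (word_deg s v) \<le> real (L + L * n)" using v(3)[of s] True by (simp only: of_nat_le_iff if_True)
        then show "real (word_deg s v) \<le> real L * (real n + 1)" by (simp add: algebra_simps)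
      qed (simp_all add: M_def)
    next
      case False
      obtain j where "j \<le> k" "s \<in> S j" using s SG_sub by auto
      then have "affordable S s 1 r" using one unfolding affordable_def by blast
      then have "affordable S s (real L * 1) ((real L)\<^sup>2 * r)"
        by (rule affordable_scale) (use L(1) in auto)
      then show ?thesis
        by (rule affordable_mono) (use v(3)[of s] False r in \<open>auto simp: M_def\<close>)
    qed
    have "affordable S s (word_deg s (v @ v')) (4 ^ length (p # ps) * (M * r))" if s: "s \<in> SG" for s
    proof -
      have "1 * (M * r) \<le> 4 ^ length ps * (M * r)" using M r by (intro mult_right_mono) auto
      then have "affordable S s (word_deg s v) (4 ^ length ps * (M * r))"
        by (intro affordable_mono[OF ad[OF s]]) auto
      from affordable_add[OF this v'(3)[OF s]] show ?thesis by (simp add: mult.assoc)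
    qed
    moreover have "word_eval G (v @ v') = power_prod G (p # ps)"
      using v v' SG_carrier p by (subst word_eval_append) auto
    ultimately show ?case using v v' by (intro exI[of _ "v @ v'"]) (simp add: image_Un)
  qed
  then show thesis using that[of M] M by blast
qed

lemma bounded_power_prod:
  obtains Q where "\<And>w. fst ` set w \<subseteq> SN \<Longrightarrow> \<exists>ps. length ps \<le> Q \<and> word_eval G w = power_prod G ps \<and>
     (\<forall>(x, n)\<in>set ps. x \<in> carrier G \<and> (x \<in> SN \<or> inv x \<in> SN) \<and> n \<le> 1 + word_deg x w + word_deg (inv x) w)"
proof -
  define A where "A = SN \<union> m_inv G ` SN"
  \<comment> \<open>The value x may come from the letter x or from the inverse of the letter
    \<open>inv x\<close>, so both degrees are added; the 1 keeps weights positive for generators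
    absent from w.\<close>
  define wt where "wt = (\<lambda>(w :: ('a \<times> bool) list) x. 1 + word_deg x w + word_deg (inv x) w)"
  have A_N: "A \<subseteq> N" unfolding A_def using SN_N N_subgroup by (auto intro: subgroup.m_inv_closed)
  interpret W: weighted_family G A wt
  proof unfold_locales
    show "A \<subseteq> carrier G" using A_N N_carrier by blast
    show "finite A" unfolding A_def using SN_finite by simp
    show "inv s \<in> A" if "s \<in> A" for s using that SN_carrier unfolding A_def by auto
    fix i s assume "s \<in> A"
    then have "s \<in> carrier G" using A_N N_carrier by blast
    then show "wt i (inv s) = wt i s" by (simp add: wt_def)
  qed (simp add: wt_def)
  \<comment> \<open>The family runs over all words, including those with foreign letters. Filtering
    makes every member a word over \<open>A\<close> and leaves words over \<open>SN\<close>
    unchanged.\<close>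
  define flt where "flt = filter (\<lambda>x :: 'a \<times> bool. fst x \<in> SN)"
  define tree where "tree = (\<lambda>x. Leaf (letter G x))"
  have "W.weighted_words 0 (\<lambda>w. word_eval G (flt w))"
  proof (rule W.weighted_wordsI[of 0 "\<lambda>w. map tree (flt w)" "\<lambda>_. 1"])
    fix w :: "('a \<times> bool) list"
    show "built_on A 0 (map tree (flt w))"
      by (auto simp: built_on_def flt_def tree_def A_def letter_def)
    show "wval G (map tree (flt w)) = word_eval G (flt w)"
      by (induction w) (auto simp: flt_def tree_def)
    have leaf: "count_list (map tree (flt w)) (Leaf y) \<le> word_deg y w + word_deg (inv y) w" for y
    proof (induction w)
      case (Cons a w)
      have "y = fst a \<or> inv y = fst a" if "fst a \<in> SN" "letter G a = y"
        using that SN_carrier by (auto simp: letter_def split: if_splits)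
      then show ?case using Cons by (auto simp: flt_def tree_def)
    qed (simp add: flt_def)
    show "count_list (map tree (flt w)) t \<le> 1 * cwt (wt w) t" for t
    proof (cases t)
      case (Leaf y)
      then show ?thesis using leaf[of y] by (simp add: wt_def)
    next
      case (Node a b)
      then have "t \<notin> set (map tree (flt w))" by (auto simp: tree_def)
      then have "count_list (map tree (flt w)) t = 0" by (rule count_notin)
      then show ?thesis by linarith
    qed
  qed
  from W.weighted_words_imp_power_products[OF N_nil A_N this] obtain Q ps where Q:
    "\<And>w. length (ps w) \<le> Q" "\<And>w s n. (s, n) \<in> set (ps w) \<Longrightarrow> s \<in> A \<and> n \<le> wt w s"
    "\<And>w. word_eval G (flt w) = power_prod G (ps w)" by (rule W.power_productsE) blast
  have "\<exists>ps. length ps \<le> Q \<and> word_eval G w = power_prod G ps \<and>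
     (\<forall>(x, n)\<in>set ps. x \<in> carrier G \<and> (x \<in> SN \<or> inv x \<in> SN) \<and> n \<le> 1 + word_deg x w + word_deg (inv x) w)"
    if w: "fst ` set w \<subseteq> SN" for w
  proof -
    have "flt w = w" using w unfolding flt_def by (auto simp: filter_id_conv)
    moreover have "x \<in> SN \<or> inv x \<in> SN" if "x \<in> A" for x using that SN_carrier by (auto simp: A_def)
    ultimately show ?thesis using Q(1)[of w] Q(2)[of _ _ w] Q(3)[of w] W.A_carrier
      by (intro exI[of _ "ps w"]) (fastforce simp: wt_def)
  qed
  then show thesis using that[of Q] by blast
qed

lemma unit_values_comparable:
  obtains B where "1 \<le> B" "\<And>i j. i \<le> k \<Longrightarrow> j \<le> k \<Longrightarrow> \<Psi> i 1 \<le> B * \<Psi> j 1"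
proof -
  define lo hi where "lo = Min ((\<lambda>i. \<Psi> i 1) ` {..k})" and "hi = Max ((\<lambda>i. \<Psi> i 1) ` {..k})"
  have "lo \<in> (\<lambda>i. \<Psi> i 1) ` {..k}" unfolding lo_def by (intro Min_in) auto
  then have lo: "0 < lo" using quadratic_scaleD(1)[OF scale] by auto
  have bounds: "lo \<le> \<Psi> i 1" "\<Psi> i 1 \<le> hi" if "i \<le> k" for i
    unfolding lo_def hi_def using that by (auto intro: Min_le Max_ge)
  have le: "lo \<le> hi" using bounds[of 0] by simp
  have "\<Psi> i 1 \<le> hi / lo * \<Psi> j 1" if "i \<le> k" "j \<le> k" for i j
  proof -
    have "\<Psi> i 1 \<le> hi / lo * lo" using bounds(2)[OF that(1)] lo by simp
    also have "\<dots> \<le> hi / lo * \<Psi> j 1" using bounds(1)[OF that(2)] lo le by (intro mult_left_mono) auto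
    finally show ?thesis .
  qed
  moreover have "1 \<le> hi / lo" using lo le by simp
  ultimately show thesis using that by blast
qed

text \<open>A nontrivial value forces a letter in w, so r is at least some \<open>\<Psi> j 1\<close>
  and, up to the factor B, every \<open>\<Psi> i 1\<close>. This pays for the extra 1 in the
  exponents and for the coset representatives.\<close>

lemma N_to_G:
  obtains C where "1 \<le> C" "\<And>w r. fst ` set w \<subseteq> SN \<Longrightarrow> word_eval G w \<noteq> \<one> \<Longrightarrow>
     (\<And>s. s \<in> SN \<Longrightarrow> affordable Xi s (word_deg s w) r) \<Longrightarrow>
     \<exists>v. fst ` set v \<subseteq> SG \<and> word_eval G v = word_eval G w \<and> (\<forall>s\<in>SG. affordable S s (word_deg s v) (C * r))"
proof -
  obtain B where B: "1 \<le> B" "\<And>i j. i \<le> k \<Longrightarrow> j \<le> k \<Longrightarrow> \<Psi> i 1 \<le> B * \<Psi> j 1"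
    by (rule unit_values_comparable) blast
  obtain Q where Q: "\<And>w. fst ` set w \<subseteq> SN \<Longrightarrow> \<exists>ps. length ps \<le> Q \<and> word_eval G w = power_prod G ps \<and>
     (\<forall>(x, n)\<in>set ps. x \<in> carrier G \<and> (x \<in> SN \<or> inv x \<in> SN) \<and> n \<le> 1 + word_deg x w + word_deg (inv x) w)"
    by (rule bounded_power_prod) blast
  obtain L where L: "1 \<le> L" "\<And>ps r. (\<And>x n. (x, n) \<in> set ps \<Longrightarrow> affordable Xi x (real n) r) \<Longrightarrow>
      (\<And>j. j \<le> k \<Longrightarrow> \<Psi> j 1 \<le> r) \<Longrightarrow> 
    \<exists>v. fst ` set v \<subseteq> SG \<and> word_eval G v = power_prod G ps \<and>
      (\<forall>s\<in>SG. affordable S s (word_deg s v) (4 ^ length ps * (L * r)))" by (rule power_prod_word) blast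
  define C where "C = 4 ^ Q * (L * (9 * B))"
  have "1 \<le> L * (9 * B)" using mult_mono[of 1 L 1 "9 * B"] L(1) B(1) by simp
  then have "1 \<le> C" unfolding C_def using mult_mono[of 1 "4 ^ Q" 1 "L * (9 * B)"] by simp
  moreover have "\<exists>v. fst ` set v \<subseteq> SG \<and> word_eval G v = word_eval G w \<and> (\<forall>s\<in>SG. affordable S s (word_deg s v) (C * r))"
    if w: "fst ` set w \<subseteq> SN" "word_eval G w \<noteq> \<one>" and r: "\<And>s. s \<in> SN \<Longrightarrow> affordable Xi s (word_deg s w) r" for w r
  proof -
    obtain a w' where a: "w = a # w'" using w(2) by (cases w) auto
    have aS: "fst a \<in> SN" using w(1) a by auto
    have r0: "0 \<le> r" using affordable_nonneg[OF r[OF aS]] by simp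
    have "affordable Xi (fst a) 1 r" by (rule affordable_mono[OF r[OF aS]]) (auto simp: a)
    then obtain j where "j \<le> k" "\<Psi> j 1 \<le> r" unfolding affordable_def by blast
    then have j: "j \<le> k" "B * \<Psi> j 1 \<le> B * r" using B(1) by (auto intro: mult_left_mono)
    have unit: "\<Psi> i 1 \<le> B * r" if "i \<le> k" for i
      using B(2)[OF that j(1)] j(2) by linarith
    have rB: "r \<le> B * r" using mult_right_mono[OF B(1) r0] by simp
    obtain ps where ps: "length ps \<le> Q" "word_eval G w = power_prod G ps"
      "\<And>x n. (x, n) \<in> set ps \<Longrightarrow> x \<in> carrier G \<and> (x \<in> SN \<or> inv x \<in> SN) \<and> n \<le> 1 + word_deg x w + word_deg (inv x) w"
      using Q[OF w(1)] by blast
    have inv_affordable: "affordable Xi x y t" if "affordable Xi s y t" "x = s \<or> x = inv s" for s x y t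
      using that Xi_inv unfolding affordable_def by blast
    have *: "affordable Xi x (real n) (9 * B * r)" if xn: "(x, n) \<in> set ps" for x n
    proof -
      have x: "x \<in> carrier G" "x \<in> SN \<or> inv x \<in> SN" "n \<le> 1 + word_deg x w + word_deg (inv x) w"
        using ps(3)[OF xn] by auto
      \<comment> \<open>The more frequent of x and its inverse, so n <= 1 + 2 deg(s). If s does not
        occur, n <= 1 is paid by the values at 1; otherwise n <= 3 deg(s), and 9 = 3^2.\<close>
      define s where "s = (if word_deg (inv x) w \<le> word_deg x w then x else inv x)"
      have xs: "x = s \<or> x = inv s" using x(1) by (auto simp: s_def)
      have n: "n \<le> 1 + 2 * word_deg s w" using x(3) by (auto simp: s_def)
      show ?thesis
      proof (cases "word_deg s w = 0")
        case True
        obtain s' where s': "s' \<in> SN" "x = s' \<or> x = inv s'" using x by (metis inv_inv)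
        then obtain i where i: "i \<le> k" "s' \<in> Xi i" using SN_sub by auto
        then have "affordable Xi s' 1 (B * r)" using unit unfolding affordable_def by blast
        then have "affordable Xi x 1 (B * r)" using s'(2) by (rule inv_affordable)
        moreover have "real n \<le> 1" using n True by simp
        moreover have "B * r \<le> 9 * B * r" using rB r0 by linarith
        ultimately show ?thesis by (rule affordable_mono[OF _ of_nat_0_le_iff])
      next
        case False
        then have "s \<in> fst ` set w" using word_deg_eq_0 by metis
        then have "s \<in> SN" using w(1) by (rule subsetD[rotated])
        from inv_affordable[OF r[OF this] xs] have "affordable Xi x (word_deg s w) r" .
        from affordable_scale[OF this, of 3] have "affordable Xi x (3 * word_deg s w) (9 * r)" by simp
        moreover have "real n \<le> real (3 * word_deg s w)" using n False by linarith
        moreover have "9 * r \<le> 9 * B * r" using rB by linarith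
        ultimately show ?thesis by (rule affordable_mono[OF _ of_nat_0_le_iff])
      qed
    qed
    have "\<Psi> j 1 \<le> 9 * B * r" if "j \<le> k" for j using unit[OF that] rB r0 by linarith
    from L(2)[OF * this] obtain v where v: "fst ` set v \<subseteq> SG" "word_eval G v = power_prod G ps"
      "\<And>s. s \<in> SG \<Longrightarrow> affordable S s (word_deg s v) (4 ^ length ps * (L * (9 * B * r)))" by blast
    have "(4::real) ^ length ps \<le> 4 ^ Q" using ps(1) by (intro power_increasing) auto
    then have "4 ^ length ps * (L * (9 * B * r)) \<le> 4 ^ Q * (L * (9 * B * r))"
      using L(1) B(1) r0 by (intro mult_right_mono) auto
    then have le: "4 ^ length ps * (L * (9 * B * r)) \<le> C * r" by (simp add: C_def mult.assoc)
    have "affordable S s (word_deg s v) (C * r)" if "s \<in> SG" for s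
      by (rule affordable_mono[OF v(3)[OF that] _ _ le]) auto
    then show ?thesis using v ps(2) by (intro exI[of _ v]) auto
  qed
  ultimately show thesis using that[of C] by blast
qed

end

section \<open>From costs of words to norms\<close>

definition wcost :: "'a set \<Rightarrow> ('a \<Rightarrow> real \<Rightarrow> real) \<Rightarrow> ('a \<times> bool) list \<Rightarrow> real" where
  "wcost \<Sigma> F w = Max (insert 0 ((\<lambda>s. inv_fun (F s) (real (word_deg s w))) ` \<Sigma>))"

lemma wnorm_eq_Inf: "g \<noteq> \<one>\<^bsub>G\<^esub> \<Longrightarrow>
    wnorm G \<Sigma> F g = Inf {ereal (wcost \<Sigma> F w) | w. fst ` set w \<subseteq> \<Sigma> \<and> word_eval G w = g}"
  by (simp add: wnorm_def wcost_def)

lemma ereal_mult_inverse_le_iff: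
  assumes "0 < C"
  shows "ereal (1 / C) * x \<le> y \<longleftrightarrow> x \<le> ereal C * y"
proof -
  have cancel: "ereal a * (ereal b * z) = z" if "a * b = 1" for a b z
    using that by (simp only: mult.assoc[symmetric] times_ereal.simps) (simp add: one_ereal_def[symmetric])
  have C: "1 / C * C = 1" "C * (1 / C) = 1" using assms by auto
  show ?thesis
  proof
    assume "ereal (1 / C) * x \<le> y"
    then have "ereal C * (ereal (1 / C) * x) \<le> ereal C * y"
      using assms by (intro ereal_mult_left_mono) auto
    then show "x \<le> ereal C * y" by (simp only: cancel[OF C(2)])
  next
    assume "x \<le> ereal C * y"
    then have "ereal (1 / C) * x \<le> ereal (1 / C) * (ereal C * y)"
      using assms by (intro ereal_mult_left_mono) auto
    then show "ereal (1 / C) * x \<le> y" by (simp only: cancel[OF C(1)])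
  qed
qed

lemma wnorm_le:
  assumes C: "1 \<le> C"
    and "\<And>w. g \<noteq> \<one>\<^bsub>G\<^esub> \<Longrightarrow> fst ` set w \<subseteq> \<Sigma> \<Longrightarrow> word_eval G w = g \<Longrightarrow>
      \<exists>v. fst ` set v \<subseteq> \<Sigma>' \<and> word_eval G v = g \<and> wcost \<Sigma>' F' v \<le> C * wcost \<Sigma> F w"
  shows "wnorm G \<Sigma>' F' g \<le> ereal C * wnorm G \<Sigma> F g"
proof (cases "g = \<one>\<^bsub>G\<^esub>")
  case True
  then show ?thesis by (simp add: wnorm_def)
next
  case False
  \<comment> \<open>With the constant on the left, the right-hand side is a bare infimum, possibly
    over the empty set.\<close>
  have "ereal (1 / C) * wnorm G \<Sigma>' F' g \<le> wnorm G \<Sigma> F g"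
    unfolding wnorm_eq_Inf[OF False, of \<Sigma>]
  proof (rule Inf_greatest)
    fix x assume "x \<in> {ereal (wcost \<Sigma> F w) | w. fst ` set w \<subseteq> \<Sigma> \<and> word_eval G w = g}"
    then obtain w where w: "x = ereal (wcost \<Sigma> F w)" "fst ` set w \<subseteq> \<Sigma>" "word_eval G w = g" by blast
    then obtain v where v: "fst ` set v \<subseteq> \<Sigma>'" "word_eval G v = g" "wcost \<Sigma>' F' v \<le> C * wcost \<Sigma> F w"
      using assms(2)[OF False] by blast
    have "wnorm G \<Sigma>' F' g \<le> ereal (wcost \<Sigma>' F' v)"
      unfolding wnorm_eq_Inf[OF False] using v by (intro Inf_lower) blast
    also have "\<dots> \<le> ereal C * x" using v(3) w(1) by simp
    finally show "ereal (1 / C) * wnorm G \<Sigma>' F' g \<le> x" using C by (simp add: ereal_mult_inverse_le_iff)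
  qed
  then show ?thesis using C by (simp add: ereal_mult_inverse_le_iff)
qed

context adapted_pair
begin

lemma affordable_wcost:
  assumes "\<Psi> = Phi \<phi>" "finite \<Sigma>" "\<Sigma> \<subseteq> (\<Union>i\<le>k. A i)" "s \<in> \<Sigma>"
  shows "affordable A s (word_deg s w) (wcost \<Sigma> (weight_fun \<phi> k A) w)"
proof -
  obtain j where j: "j \<le> k" "s \<in> A j" using assms by auto
  obtain i where i: "i \<le> k" "s \<in> A i" "Phi \<phi> i (word_deg s w) \<le> inv_fun (weight_fun \<phi> k A s) (word_deg s w)"
    using inv_weight_lower[where s = s and A = A and j = j and k = k and \<phi> = \<phi> and y = "real (word_deg s w)"]
      scale[unfolded assms(1)] j by auto
  have "inv_fun (weight_fun \<phi> k A s) (word_deg s w) \<le> wcost \<Sigma> (weight_fun \<phi> k A) w"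
    unfolding wcost_def using assms by (intro Max_ge) auto
  then show ?thesis unfolding affordable_def unfolding assms(1) using i by (intro exI[of _ i]) auto
qed

text \<open>The factor 4 stems from \<open>inv_weight_upper\<close>; the translation in the other
  direction loses nothing.\<close>

lemma wcost_affordable:
  assumes "\<Psi> = Phi \<phi>" "finite \<Sigma>" "\<And>s. s \<in> \<Sigma> \<Longrightarrow> affordable A s (word_deg s v) r" "0 \<le> r"
  shows "wcost \<Sigma> (weight_fun \<phi> k A) v \<le> 4 * r"
proof -
  have "inv_fun (weight_fun \<phi> k A s) (word_deg s v) \<le> 4 * r" if s: "s \<in> \<Sigma>" for s
  proof -
    obtain i where i: "i \<le> k" "s \<in> A i" "Phi \<phi> i (word_deg s v) \<le> r"
      using assms(3)[OF s] unfolding affordable_def unfolding assms(1) by blast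
    have "inv_fun (weight_fun \<phi> k A s) (word_deg s v) \<le> 4 * Phi \<phi> i (word_deg s v)"
      using scale[unfolded assms(1)] i by (intro inv_weight_upper[where j = i]) auto
    then show ?thesis using i(3) by linarith
  qed
  then show ?thesis unfolding wcost_def using assms by (subst Max_le_iff) auto
qed

lemma wnorm_equivalent:
  assumes Psi: "\<Psi> = Phi \<phi>"
  shows "\<exists>c C. 0 < c \<and> c \<le> C \<and> (\<forall>g\<in>N.
      ereal c * wnorm G SG (weight_fun \<phi> k S) g \<le> wnorm G SN (weight_fun \<phi> k Xi) g \<and>
      wnorm G SN (weight_fun \<phi> k Xi) g \<le> ereal C * wnorm G SG (weight_fun \<phi> k S) g)"
proof -
  obtain C1 where C1: "1 \<le> C1" "\<And>w r. fst ` set w \<subseteq> SG \<Longrightarrow> word_eval G w \<in> N \<Longrightarrow> 0 \<le> r \<Longrightarrow>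
     (\<And>s. s \<in> SG \<Longrightarrow> affordable S s (word_deg s w) r) \<Longrightarrow>
     \<exists>v. fst ` set v \<subseteq> SN \<and> word_eval G v = word_eval G w \<and> (\<forall>x\<in>SN. affordable Xi x (word_deg x v) (C1 * r))"
    by (rule G_to_N) blast
  obtain C2 where C2: "1 \<le> C2" "\<And>w r. fst ` set w \<subseteq> SN \<Longrightarrow> word_eval G w \<noteq> \<one> \<Longrightarrow>
     (\<And>s. s \<in> SN \<Longrightarrow> affordable Xi s (word_deg s w) r) \<Longrightarrow>
     \<exists>v. fst ` set v \<subseteq> SG \<and> word_eval G v = word_eval G w \<and> (\<forall>s\<in>SG. affordable S s (word_deg s v) (C2 * r))"
    by (rule N_to_G) blast
  have nn: "0 \<le> wcost \<Sigma> F w" if "finite \<Sigma>" for \<Sigma> and F :: "'a \<Rightarrow> real \<Rightarrow> real" and w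
    unfolding wcost_def using that by (intro Max_ge) auto
  have lower: "wnorm G SG (weight_fun \<phi> k S) g \<le> ereal (4 * C2) * wnorm G SN (weight_fun \<phi> k Xi) g" for g
  proof (rule wnorm_le)
    fix w assume g: "g \<noteq> \<one>" and w: "fst ` set w \<subseteq> SN" "word_eval G w = g"
    let ?r = "wcost SN (weight_fun \<phi> k Xi) w"
    have ne: "word_eval G w \<noteq> \<one>" using g w by simp
    from C2(2)[OF w(1) ne affordable_wcost[OF Psi SN_finite SN_sub]] obtain v where v: "fst ` set v \<subseteq> SG"
      "word_eval G v = word_eval G w" "\<And>s. s \<in> SG \<Longrightarrow> affordable S s (word_deg s v) (C2 * ?r)" by blast
    have "wcost SG (weight_fun \<phi> k S) v \<le> 4 * (C2 * ?r)"
      using nn[OF SN_finite] C2(1) by (intro wcost_affordable[OF Psi SG_finite v(3)]) auto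
    then show "\<exists>v. fst ` set v \<subseteq> SG \<and> word_eval G v = g \<and> wcost SG (weight_fun \<phi> k S) v \<le> 4 * C2 * ?r"
      using v w by (intro exI[of _ v]) (simp add: mult.assoc)
  qed (use C2 in simp)
  have upper: "wnorm G SN (weight_fun \<phi> k Xi) g \<le> ereal (4 * C1) * wnorm G SG (weight_fun \<phi> k S) g" if g: "g \<in> N" for g
  proof (rule wnorm_le)
    fix w assume w: "fst ` set w \<subseteq> SG" "word_eval G w = g"
    let ?r = "wcost SG (weight_fun \<phi> k S) w"
    have wN: "word_eval G w \<in> N" using w g by simp
    from C1(2)[OF w(1) wN nn[OF SG_finite] affordable_wcost[OF Psi SG_finite SG_sub]] obtain v where
      v: "fst ` set v \<subseteq> SN" "word_eval G v = word_eval G w" "\<And>s. s \<in> SN \<Longrightarrow> affordable Xi s (word_deg s v) (C1 * ?r)"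
      by blast
    have "wcost SN (weight_fun \<phi> k Xi) v \<le> 4 * (C1 * ?r)"
      using nn[OF SG_finite] C1(1) by (intro wcost_affordable[OF Psi SN_finite v(3)]) auto
    then show "\<exists>v. fst ` set v \<subseteq> SN \<and> word_eval G v = g \<and> wcost SN (weight_fun \<phi> k Xi) v \<le> 4 * C1 * ?r"
      using v w by (intro exI[of _ v]) (simp add: mult.assoc)
  qed (use C1 in simp)
  have pos: "0 < 4 * C2" using C2 by simp
  have "1 / (4 * C2) \<le> 1" using C2(1) by simp
  then have "1 / (4 * C2) \<le> 4 * C1" using C1(1) by linarith
  then show ?thesis using pos lower upper
    by (intro exI[of _ "1 / (4 * C2)"] exI[of _ "4 * C1"]) (simp only: ereal_mult_inverse_le_iff[OF pos], simp)
qed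

end

theorem mainTheorem6:
  fixes G :: "('a, 'b) monoid_scheme"
    and k :: nat and p :: "nat \<Rightarrow> real" and \<mu>s :: "nat \<Rightarrow> 'a \<Rightarrow> real" and \<mu> :: "'a \<Rightarrow> real"
    and H :: "nat \<Rightarrow> 'a set" and T :: "nat \<Rightarrow> 'a set" and d :: "nat \<Rightarrow> real"
    and \<phi> :: "nat \<Rightarrow> real \<Rightarrow> real"
    and N :: "'a set" and m :: nat and u :: "nat \<Rightarrow> 'a"
    and S :: "nat \<Rightarrow> 'a set" and \<Xi>0 :: "'a set"
    and \<Sigma>G :: "'a set" and \<Sigma>N :: "'a set"
  assumes grp: "group G"
    \<comment> \<open>G finitely generated of polynomial volume growth\<close>
    and growth: "\<exists>S0 dG. fin_sym_gen G S0 (carrier G) \<and> poly_growth_deg G S0 (carrier G) dG"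
    \<comment> \<open>\<mu> \<in> P(G,reg)\<close>
    and p0: "p 0 \<ge> 0" and p_pos: "\<And>i. 1 \<le> i \<Longrightarrow> i \<le> k \<Longrightarrow> p i > 0"
    and p_sum: "(\<Sum>i\<le>k. p i) = 1"
    and mu_def: "\<And>g. \<mu> g = (\<Sum>i\<le>k. p i * \<mu>s i g)"
    and mu_nonneg: "\<And>i g. i \<le> k \<Longrightarrow> \<mu>s i g \<ge> 0"
    and mu_supp: "\<And>i g. i \<le> k \<Longrightarrow> g \<notin> carrier G \<Longrightarrow> \<mu>s i g = 0"
    and mu_prob: "\<And>i. i \<le> k \<Longrightarrow> (\<mu>s i has_sum 1) (carrier G)"
    and mu_sym: "\<And>i g. i \<le> k \<Longrightarrow> g \<in> carrier G \<Longrightarrow> \<mu>s i (inv\<^bsub>G\<^esub> g) = \<mu>s i g"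
    and mu0_fin: "finite {g. \<mu>s 0 g \<noteq> 0}"
    and H_sub: "\<And>i. 1 \<le> i \<Longrightarrow> i \<le> k \<Longrightarrow> subgroup (H i) G"
    and H_gen: "\<And>i. 1 \<le> i \<Longrightarrow> i \<le> k \<Longrightarrow> fin_sym_gen G (T i) (H i)"
    and H_growth: "\<And>i. 1 \<le> i \<Longrightarrow> i \<le> k \<Longrightarrow> poly_growth_deg G (T i) (H i) (d i)"
    and mu_on_H: "\<And>i. 1 \<le> i \<Longrightarrow> i \<le> k \<Longrightarrow> (\<exists>c1 c2. 0 < c1 \<and> c1 \<le> c2 \<and>
        (\<forall>h\<in>H i. c1 / (\<phi> i (1 + real (word_length G (T i) h)) * (1 + real (word_length G (T i) h)) powr d i)
                    \<le> \<mu>s i h \<and>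
                  \<mu>s i h \<le> c2 / (\<phi> i (1 + real (word_length G (T i) h)) * (1 + real (word_length G (T i) h)) powr d i)))"
    and mu_off_H: "\<And>i g. 1 \<le> i \<Longrightarrow> i \<le> k \<Longrightarrow> g \<notin> H i \<Longrightarrow> \<mu>s i g = 0"
    and phi_pos: "\<And>i t. 1 \<le> i \<Longrightarrow> i \<le> k \<Longrightarrow> t \<ge> 0 \<Longrightarrow> \<phi> i t > 0"
    and phi_mono: "\<And>i. 1 \<le> i \<Longrightarrow> i \<le> k \<Longrightarrow> mono_on {0..} (\<phi> i)"
    and phi_reg: "\<And>i. 1 \<le> i \<Longrightarrow> i \<le> k \<Longrightarrow> \<exists>\<gamma>>0. regularly_varying (\<phi> i) \<gamma>"
    and gen_eps: "\<exists>\<epsilon>>0. \<one>\<^bsub>G\<^esub> \<in> {g \<in> carrier G. \<mu> g > \<epsilon>} \<and>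
                     generate G {g \<in> carrier G. \<mu> g > \<epsilon>} = carrier G"
    and Phi_comp: "\<And>i j. 1 \<le> i \<Longrightarrow> i \<le> k \<Longrightarrow> 1 \<le> j \<Longrightarrow> j \<le> k \<Longrightarrow> i \<noteq> j \<Longrightarrow>
        preceq_inf (Phi \<phi> i) (Phi \<phi> j) \<or> preceq_inf (Phi \<phi> j) (Phi \<phi> i)"
    \<comment> \<open>normal nilpotent subgroup of finite index, with right coset representatives\<close>
    and N_normal: "N \<lhd> G" and N_nil: "nilpotent_subgroup G N"
    and u0: "u 0 = \<one>\<^bsub>G\<^esub>" and u_carr: "\<And>l. l \<le> m \<Longrightarrow> u l \<in> carrier G"
    and u_cover: "carrier G = (\<Union>l\<le>m. N #>\<^bsub>G\<^esub> u l)"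
    and u_disj: "\<And>l l'. l \<le> m \<Longrightarrow> l' \<le> m \<Longrightarrow> l \<noteq> l' \<Longrightarrow> (N #>\<^bsub>G\<^esub> u l) \<inter> (N #>\<^bsub>G\<^esub> u l') = {}"
    \<comment> \<open>generating sets\<close>
    and S0: "fin_sym_gen G (S 0) (carrier G)"
    and Si: "\<And>i. 1 \<le> i \<Longrightarrow> i \<le> k \<Longrightarrow> fin_sym_gen G (S i) (N \<inter> H i)"
    and Xi0: "fin_sym_gen G \<Xi>0 N"
    \<comment> \<open>the adapted pair of geometries\<close>
    and SigmaG: "reps_mod_inv G \<Sigma>G ((\<Union>i\<le>k. S i) - {\<one>\<^bsub>G\<^esub>})"
    and SigmaN: "reps_mod_inv G \<Sigma>N ((\<Union>i\<le>k. (if i = 0 then \<Xi>0 else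
                    (\<Union>l\<le>m. (\<lambda>s. u l \<otimes>\<^bsub>G\<^esub> s \<otimes>\<^bsub>G\<^esub> inv\<^bsub>G\<^esub> (u l)) ` S i))) - {\<one>\<^bsub>G\<^esub>})"
  shows "\<exists>c C. 0 < c \<and> c \<le> C \<and>
    (\<forall>g\<in>N.
      ereal c * wnorm G \<Sigma>G (weight_fun \<phi> k S) g
        \<le> wnorm G \<Sigma>N (weight_fun \<phi> k (\<lambda>i. if i = 0 then \<Xi>0 else
              (\<Union>l\<le>m. (\<lambda>s. u l \<otimes>\<^bsub>G\<^esub> s \<otimes>\<^bsub>G\<^esub> inv\<^bsub>G\<^esub> (u l)) ` S i))) g
      \<and> wnorm G \<Sigma>N (weight_fun \<phi> k (\<lambda>i. if i = 0 then \<Xi>0 else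
              (\<Union>l\<le>m. (\<lambda>s. u l \<otimes>\<^bsub>G\<^esub> s \<otimes>\<^bsub>G\<^esub> inv\<^bsub>G\<^esub> (u l)) ` S i))) g
        \<le> ereal C * wnorm G \<Sigma>G (weight_fun \<phi> k S) g)"
proof -
  define Xi where "Xi = (\<lambda>i. if i = 0 then \<Xi>0 else (\<Union>l\<le>m. (\<lambda>s. u l \<otimes>\<^bsub>G\<^esub> s \<otimes>\<^bsub>G\<^esub> inv\<^bsub>G\<^esub> (u l)) ` S i))"
  have Phi: "quadratic_scale (Phi \<phi> i)" "\<exists>K>0. \<forall>t\<ge>1. Phi \<phi> i t \<le> K * Phi \<phi> 0 t" if "i \<le> k" for i
  proof -
    have sq: "Phi \<phi> 0 t = t\<^sup>2" if "1 \<le> t" for t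
      using that by (simp add: Phi_def Phi0_def power2_eq_square)
    have "quadratic_scale (Phi \<phi> i) \<and> (\<exists>K>0. \<forall>t\<ge>1. Phi \<phi> i t \<le> K * t\<^sup>2)"
    proof (cases "i = 0")
      case True
      then show ?thesis using quadratic_scale_Phi0 sq by (auto simp: Phi_def intro!: exI[of _ 1])
    next
      case False
      then have i: "1 \<le> i" "i \<le> k" using that by auto
      obtain \<gamma> where g: "\<gamma> > 0" "regularly_varying (\<phi> i) \<gamma>" using phi_reg[OF i] by blast
      \<comment> \<open>The positive index makes \<open>\<phi> i\<close> unbounded, and through it
        \<open>Phi \<phi> i\<close>.\<close>
      note unb = regularly_varying_unbounded[OF phi_pos[OF i] g]
      show ?thesis
        using quadratic_scale_PhiI[OF phi_pos[OF i] phi_mono[OF i] unb] False by (simp add: Phi_def)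
    qed
    then show "quadratic_scale (Phi \<phi> i)" "\<exists>K>0. \<forall>t\<ge>1. Phi \<phi> i t \<le> K * Phi \<phi> 0 t"
      using sq by auto
  qed
  have "adapted_pair G k N m u S H Xi \<Sigma>G \<Sigma>N (Phi \<phi>)"
  proof (intro adapted_pair.intro adapted_pair_axioms.intro)
    show "reps_mod_inv G \<Sigma>N ((\<Union>i\<le>k. Xi i) - {\<one>\<^bsub>G\<^esub>})" using SigmaN by (simp only: Xi_def)
    show "fin_sym_gen G (Xi 0) N" using Xi0 by (simp add: Xi_def)
    show "Xi i = (\<Union>l\<le>m. (\<lambda>s. u l \<otimes>\<^bsub>G\<^esub> s \<otimes>\<^bsub>G\<^esub> inv\<^bsub>G\<^esub> (u l)) ` S i)" if "1 \<le> i" for i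
      using that by (simp add: Xi_def)
  qed (fact grp Phi N_normal N_nil u0 u_carr u_cover u_disj S0 Si SigmaG)+
  from adapted_pair.wnorm_equivalent[OF this refl] show ?thesis unfolding Xi_def .
qed

end
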